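(* Let $\varepsilon>0$ and let $c\in\mathscr{K}$ be in $W^{1,\infty}([0,H])$. Then $c$ satisfies the minimal amplitude hypothesis with respect to $\mathscr{A}^c_\varepsilon$, i.e. $$\mathfrak{r}_{c,\varepsilon}^2=\inf_{y\in[0,H],\ (\mu_k,\lambda)\in\mathscr{A}^c_\varepsilon}\big[u_{\lambda,k}(y)^2+(c(y)u_{\lambda,k}'(y))^2\big]>0.$$
   Context: $\Omega'\subset\mathbb{R}^d$ ($d\ge1$) is a fixed bounded smooth open domain and $H>0$ is fixed. $\mu_1^2\le\mu_2^2\le\cdots$ (with $\mu_k>0$) are the eigenvalues, counted with multiplicity, of the Dirichlet Laplacian in $L^2(\Omega')$. Fix $0<c_m<c_M$; $\mathscr{K}$ is the set of all $c\in L^\infty([0,H])$ with $\operatorname{ess\,inf}c=c_m$ and $\operatorname{ess\,sup}c=c_M$. For $c\in\mathscr{K}$ and $k\ge1$, $$A_k=c(y)\mu_k^2-\frac{d}{dy}c(y)\frac{d}{dy}\ \text{ in }L^2(0,H),\qquad D(A_k)=\{u\in H^1_0(0,H):\ cu'\in H^1(0,H)\},$$ is self-adjoint with simple eigenvalues $\beta_{k,1}<\beta_{k,2}<\cdots$. If $\lambda=\beta_{k,\ell}$, $u_{\lambda,k}$ denotes the (real) eigenfunction of $A_k$ for $\lambda$, normalized in $L^2(0,H)$; it solves $(cu')'+(\lambda-c\mu_k^2)u=0$, $u(0)=u(H)=0$. $cu_{\lambda,k}'$ is understood as its continuous representative. $\mathscr{A}^c_\varepsilon=\bigcup_{k\ge1}\{(\mu_k,\lambda):\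 \lambda=\beta_{k,\ell}\text{ for some }\ell\ge1,\ \lambda\ge(c_M+\varepsilon)\mu_k^2\}$. *)

theory Defs
  imports "HOL-Analysis.Analysis" "HOL-Probability.Essential_Supremum"
begin

section \<open>Smooth functions and smooth bounded domains\<close>

primrec Ck_on :: "nat \<Rightarrow> 'a::euclidean_space set \<Rightarrow> ('a \<Rightarrow> real) \<Rightarrow> bool" where
  "Ck_on 0 S f \<longleftrightarrow> continuous_on S f"
| "Ck_on (Suc n) S f \<longleftrightarrow>
     (\<forall>x\<in>S. f differentiable (at x)) \<and>
     (\<forall>b\<in>Basis. Ck_on n S (\<lambda>x. frechet_derivative f (at x) b))"

definition smooth_on :: "'a::euclidean_space set \<Rightarrow> ('a \<Rightarrow> real) \<Rightarrow> bool" where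
  "smooth_on S f \<longleftrightarrow> (\<forall>n. Ck_on n S f)"

text \<open>Smoothness of the boundary is expressed by local defining functions: near each boundary
  point the domain is a strict sublevel set of a smooth function without critical points.\<close>

definition bounded_smooth_domain :: "'a::euclidean_space set \<Rightarrow> bool" where
  "bounded_smooth_domain \<Omega> \<longleftrightarrow>
     open \<Omega> \<and> bounded \<Omega> \<and> connected \<Omega> \<and> \<Omega> \<noteq> {} \<and>
     (\<forall>p\<in>frontier \<Omega>. \<exists>U \<psi>. open U \<and> p \<in> U \<and> smooth_on U \<psi> \<and>
        (\<forall>x\<in>U. \<exists>b\<in>Basis. frechet_derivative \<psi> (at x) b \<noteq> 0) \<and>
        \<Omega> \<inter> U = {x\<in>U. \<psi> x < 0})"

definition test_function :: "'a::euclidean_space set \<Rightarrow> ('a \<Rightarrow> real) \<Rightarrow> bool" where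
  "test_function S \<phi> \<longleftrightarrow>
     smooth_on UNIV \<phi> \<and> compact (closure {x. \<phi> x \<noteq> 0}) \<and> closure {x. \<phi> x \<noteq> 0} \<subseteq> S"


section \<open>Lebesgue and Sobolev spaces on an open set\<close>

text \<open>Elements of these spaces are represented by functions on the whole type; only the values
  almost everywhere on the given set matter.\<close>

definition loc_integrable :: "'a::euclidean_space set \<Rightarrow> ('a \<Rightarrow> real) \<Rightarrow> bool" where
  "loc_integrable S f \<longleftrightarrow> (\<forall>K. compact K \<and> K \<subseteq> S \<longrightarrow> integrable (lebesgue_on K) f)"

definition L2 :: "'a::euclidean_space set \<Rightarrow> ('a \<Rightarrow> real) set" where
  "L2 S = {f. f \<in> borel_measurable (lebesgue_on S) \<and> integrable (lebesgue_on S) (\<lambda>x. (f x)\<^sup>2)}"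

definition L_infty :: "'a::euclidean_space set \<Rightarrow> ('a \<Rightarrow> real) set" where
  "L_infty S = {f. f \<in> borel_measurable (lebesgue_on S) \<and>
                   esssup (lebesgue_on S) (\<lambda>x. ereal \<bar>f x\<bar>) < \<infinity>}"

definition has_weak_deriv ::
  "'a::euclidean_space set \<Rightarrow> 'a \<Rightarrow> ('a \<Rightarrow> real) \<Rightarrow> ('a \<Rightarrow> real) \<Rightarrow> bool" where
  "has_weak_deriv S b u v \<longleftrightarrow>
     loc_integrable S u \<and> loc_integrable S v \<and>
     (\<forall>\<phi>. test_function S \<phi> \<longrightarrow>
        (LINT x|lebesgue_on S. u x * frechet_derivative \<phi> (at x) b) =
        - (LINT x|lebesgue_on S. v x * \<phi> x))"

text \<open>The weak derivative, when it exists, is determined almost everywhere on \<open>S\<close>.\<close>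

definition weak_deriv :: "'a::euclidean_space set \<Rightarrow> 'a \<Rightarrow> ('a \<Rightarrow> real) \<Rightarrow> ('a \<Rightarrow> real)" where
  "weak_deriv S b u = (SOME v. has_weak_deriv S b u v)"

definition H1 :: "'a::euclidean_space set \<Rightarrow> ('a \<Rightarrow> real) set" where
  "H1 S = {u \<in> L2 S. \<forall>b\<in>Basis. \<exists>v\<in>L2 S. has_weak_deriv S b u v}"

definition W1_infty :: "'a::euclidean_space set \<Rightarrow> ('a \<Rightarrow> real) set" where
  "W1_infty S = {u \<in> L_infty S. \<forall>b\<in>Basis. \<exists>v\<in>L_infty S. has_weak_deriv S b u v}"

text \<open>The closure of the test functions in the norm of \<open>H1\<close>.\<close>

definition H10 :: "'a::euclidean_space set \<Rightarrow> ('a \<Rightarrow> real) set" where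
  "H10 S = {u \<in> H1 S. \<exists>\<phi>. (\<forall>n. test_function S (\<phi> n)) \<and>
     (\<lambda>n. LINT x|lebesgue_on S. (\<phi> n x - u x)\<^sup>2) \<longlonglongrightarrow> 0 \<and>
     (\<forall>b\<in>Basis. (\<lambda>n. LINT x|lebesgue_on S.
        (frechet_derivative (\<phi> n) (at x) b - weak_deriv S b u x)\<^sup>2) \<longlonglongrightarrow> 0)}"


section \<open>The Dirichlet Laplacian\<close>

definition laplacian :: "('a::euclidean_space \<Rightarrow> real) \<Rightarrow> 'a \<Rightarrow> real" where
  "laplacian \<phi> x =
     (\<Sum>b\<in>Basis. frechet_derivative (\<lambda>z. frechet_derivative \<phi> (at z) b) (at x) b)"

definition has_weak_laplacian ::
  "'a::euclidean_space set \<Rightarrow> ('a \<Rightarrow> real) \<Rightarrow> ('a \<Rightarrow> real) \<Rightarrow> bool" where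
  "has_weak_laplacian S u f \<longleftrightarrow>
     loc_integrable S u \<and> loc_integrable S f \<and>
     (\<forall>\<phi>. test_function S \<phi> \<longrightarrow>
        (LINT x|lebesgue_on S. u x * laplacian \<phi> x) = (LINT x|lebesgue_on S. f x * \<phi> x))"

text \<open>The Dirichlet Laplacian has domain \<open>{u \<in> H10 \<Omega>. \<Delta>u \<in> L2 \<Omega>}\<close>; for an eigenfunction the
  condition \<open>\<Delta>u \<in> L2 \<Omega>\<close> is automatic.\<close>

definition dirichlet_eigenspace :: "'a::euclidean_space set \<Rightarrow> real \<Rightarrow> ('a \<Rightarrow> real) set" where
  "dirichlet_eigenspace \<Omega> \<Lambda> = {u \<in> H10 \<Omega>. has_weak_laplacian \<Omega> u (\<lambda>x. - (\<Lambda> * u x))}"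

text \<open>\<open>V\<close> has dimension \<open>n\<close> after identification of functions that agree almost everywhere on \<open>S\<close>.\<close>

definition has_dim_ae :: "'a::euclidean_space set \<Rightarrow> ('a \<Rightarrow> real) set \<Rightarrow> nat \<Rightarrow> bool" where
  "has_dim_ae S V n \<longleftrightarrow>
     (\<exists>e. (\<forall>i<n. e i \<in> V) \<and>
        (\<forall>a. (AE x in lebesgue_on S. (\<Sum>i<n. a i * e i x) = 0) \<longrightarrow> (\<forall>i<n. a i = (0::real))) \<and>
        (\<forall>u\<in>V. \<exists>a. AE x in lebesgue_on S. u x = (\<Sum>i<n. a i * e i x)))"

text \<open>\<open>(\<mu> 1)\<^sup>2 \<le> (\<mu> 2)\<^sup>2 \<le> \<dots>\<close> lists the eigenvalues with multiplicity; indices start at 1 and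
  \<open>\<mu> 0\<close> is irrelevant.\<close>

definition dirichlet_eigenvalues :: "'a::euclidean_space set \<Rightarrow> (nat \<Rightarrow> real) \<Rightarrow> bool" where
  "dirichlet_eigenvalues \<Omega> \<mu> \<longleftrightarrow>
     (\<forall>k\<ge>1. \<mu> k > 0) \<and>
     (\<forall>j k. 1 \<le> j \<and> j \<le> k \<longrightarrow> (\<mu> j)\<^sup>2 \<le> (\<mu> k)\<^sup>2) \<and>
     (\<forall>\<Lambda>. finite {k. k \<ge> 1 \<and> (\<mu> k)\<^sup>2 = \<Lambda>} \<and>
          has_dim_ae \<Omega> (dirichlet_eigenspace \<Omega> \<Lambda>) (card {k. k \<ge> 1 \<and> (\<mu> k)\<^sup>2 = \<Lambda>}))"


section \<open>Coefficients and the operators on \<open>(0, H)\<close>\<close>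

definition essinf :: "'a measure \<Rightarrow> ('a \<Rightarrow> ereal) \<Rightarrow> ereal" where
  "essinf M f = - esssup M (\<lambda>x. - f x)"

definition coefficients :: "real \<Rightarrow> real \<Rightarrow> real \<Rightarrow> (real \<Rightarrow> real) set" where
  "coefficients H c\<^sub>m c\<^sub>M = {c \<in> L_infty {0..H}.
     essinf (lebesgue_on {0..H}) (\<lambda>y. ereal (c y)) = ereal c\<^sub>m \<and>
     esssup (lebesgue_on {0..H}) (\<lambda>y. ereal (c y)) = ereal c\<^sub>M}"

abbreviation wd :: "real \<Rightarrow> (real \<Rightarrow> real) \<Rightarrow> (real \<Rightarrow> real)" where
  "wd H u \<equiv> weak_deriv {0<..<H} 1 u"

definition A_dom :: "real \<Rightarrow> (real \<Rightarrow> real) \<Rightarrow> (real \<Rightarrow> real) set" where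
  "A_dom H c = {u \<in> H10 {0<..<H}. (\<lambda>y. c y * wd H u y) \<in> H1 {0<..<H}}"

text \<open>In the following, \<open>m\<close> stands for \<open>\<mu> k\<close>, on which alone the operator \<open>A\<^sub>k\<close> depends.\<close>

definition A_op :: "real \<Rightarrow> (real \<Rightarrow> real) \<Rightarrow> real \<Rightarrow> (real \<Rightarrow> real) \<Rightarrow> (real \<Rightarrow> real)" where
  "A_op H c m u = (\<lambda>y. c y * m\<^sup>2 * u y - wd H (\<lambda>z. c z * wd H u z) y)"

definition A_eigenfunction :: "real \<Rightarrow> (real \<Rightarrow> real) \<Rightarrow> real \<Rightarrow> real \<Rightarrow> (real \<Rightarrow> real) \<Rightarrow> bool" where
  "A_eigenfunction H c m lam u \<longleftrightarrow>
     u \<in> A_dom H c \<and>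
     \<not> (AE y in lebesgue_on {0<..<H}. u y = 0) \<and>
     (AE y in lebesgue_on {0<..<H}. A_op H c m u y = lam * u y)"

definition A_eigenvalues :: "real \<Rightarrow> (real \<Rightarrow> real) \<Rightarrow> real \<Rightarrow> real set" where
  "A_eigenvalues H c m = {lam. \<exists>u. A_eigenfunction H c m lam u}"

definition normalized_eigenfunction ::
  "real \<Rightarrow> (real \<Rightarrow> real) \<Rightarrow> real \<Rightarrow> real \<Rightarrow> (real \<Rightarrow> real) \<Rightarrow> bool" where
  "normalized_eigenfunction H c m lam u \<longleftrightarrow>
     A_eigenfunction H c m lam u \<and> (LINT y|lebesgue_on {0<..<H}. (u y)\<^sup>2) = 1"

text \<open>\<open>\<beta> k 1 < \<beta> k 2 < \<dots>\<close> are the eigenvalues of \<open>A\<^sub>k\<close>, for each \<open>k \<ge> 1\<close>.\<close>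

definition A_eigenvalue_enumeration ::
  "real \<Rightarrow> (real \<Rightarrow> real) \<Rightarrow> (nat \<Rightarrow> real) \<Rightarrow> (nat \<Rightarrow> nat \<Rightarrow> real) \<Rightarrow> bool" where
  "A_eigenvalue_enumeration H c \<mu> \<beta> \<longleftrightarrow>
     (\<forall>k\<ge>1. strict_mono_on {1..} (\<beta> k) \<and> \<beta> k ` {1..} = A_eigenvalues H c (\<mu> k))"


section \<open>Minimal amplitude\<close>

definition A_eps :: "(nat \<Rightarrow> real) \<Rightarrow> (nat \<Rightarrow> nat \<Rightarrow> real) \<Rightarrow> real \<Rightarrow> real \<Rightarrow> (real \<times> real) set" where
  "A_eps \<mu> \<beta> c\<^sub>M \<epsilon> =
     (\<Union>k\<in>{1..}. {(\<mu> k, lam) | lam. (\<exists>l\<ge>1. lam = \<beta> k l) \<and> lam \<ge> (c\<^sub>M + \<epsilon>) * (\<mu> k)\<^sup>2})"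

text \<open>The continuous representative on \<open>[0, H]\<close> of a class of functions on \<open>(0, H)\<close>;
  it is unique on \<open>[0, H]\<close> and exists for every element of \<open>H1 {0<..<H}\<close>.\<close>

definition cont_rep :: "real \<Rightarrow> (real \<Rightarrow> real) \<Rightarrow> (real \<Rightarrow> real)" where
  "cont_rep H f =
     (SOME g. continuous_on {0..H} g \<and> (AE y in lebesgue_on {0<..<H}. f y = g y))"

definition amplitude_sq :: "real \<Rightarrow> (real \<Rightarrow> real) \<Rightarrow> (real \<Rightarrow> real) \<Rightarrow> real \<Rightarrow> real" where
  "amplitude_sq H c u y = (cont_rep H u y)\<^sup>2 + (cont_rep H (\<lambda>z. c z * wd H u z) y)\<^sup>2"

text \<open>\<open>u lam k\<close> plays the role of the eigenfunction of \<open>A\<^sub>k\<close> for \<open>lam\<close>. The infimum is taken in the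
  extended reals, where the infimum of the empty set is \<open>\<infinity>\<close>.\<close>

definition min_amplitude_sq ::
  "real \<Rightarrow> (real \<Rightarrow> real) \<Rightarrow> (nat \<Rightarrow> real) \<Rightarrow> (real \<Rightarrow> nat \<Rightarrow> real \<Rightarrow> real) \<Rightarrow>
   (real \<times> real) set \<Rightarrow> ereal" where
  "min_amplitude_sq H c \<mu> u A =
     (INF (y, k, lam) \<in> {(y, k, lam). y \<in> {0..H} \<and> k \<ge> 1 \<and> (\<mu> k, lam) \<in> A}.
        ereal (amplitude_sq H c (u lam k) y))"

definition minimal_amplitude ::
  "real \<Rightarrow> (real \<Rightarrow> real) \<Rightarrow> (nat \<Rightarrow> real) \<Rightarrow> (real \<Rightarrow> nat \<Rightarrow> real \<Rightarrow> real) \<Rightarrow>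
   (real \<times> real) set \<Rightarrow> bool" where
  "minimal_amplitude H c \<mu> u A \<longleftrightarrow> min_amplitude_sq H c \<mu> u A > 0"

end

theory Submission
  imports Defs
begin

text \<open>Write \<open>U\<close> and \<open>P\<close> for the continuous representatives of an eigenfunction \<open>u\<close> and of \<open>c u'\<close>.
  Since \<open>c\<close> has a Lipschitz representative \<open>C\<close> with values in \<open>[c\<^sub>m, c\<^sub>M]\<close>, both are classically
  differentiable on \<open>[0, H]\<close>, with \<open>U' = P / C\<close> and \<open>P' = - q U\<close>, where \<open>q = \<lambda> - C \<mu>\<^sup>2\<close>.
  The condition \<open>\<lambda> \<ge> (c\<^sub>M + \<epsilon>) \<mu>\<^sup>2\<close> gives \<open>\<delta> \<lambda> \<le> q \<le> \<lambda>\<close> with \<open>\<delta> = \<epsilon> / (c\<^sub>M + \<epsilon>)\<close>, which is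
  independent of the eigenvalue.

  Consider the energy \<open>E = P\<^sup>2 + C q U\<^sup>2\<close>. In its derivative the terms with \<open>U P\<close> cancel and
  only \<open>(C q)' U\<^sup>2\<close> remains. The weight \<open>C q\<close> has Lipschitz constant at most \<open>L \<lambda>\<close> if \<open>C\<close> has
  Lipschitz constant \<open>L\<close>, and \<open>C q \<ge> c\<^sub>m \<delta> \<lambda>\<close>, so the logarithmic derivative of \<open>E\<close> is bounded by
  \<open>L / (c\<^sub>m \<delta>)\<close>: both factors \<open>\<lambda>\<close> disappear. Hence the values of \<open>E\<close> at any two points of \<open>[0, H]\<close> are
  comparable up to a constant that depends on neither \<open>\<mu>\<close> nor \<open>\<lambda>\<close> (\<open>energy_comparison\<close>). The
  normalization provides a point \<open>z\<close> with \<open>U(z)\<^sup>2 \<ge> 1 / H\<close>, where \<open>E(z) \<ge> c\<^sub>m \<delta> \<lambda> / H\<close>; and everywhere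
  \<open>E \<le> (1 + c\<^sub>M \<lambda>) (U\<^sup>2 + P\<^sup>2)\<close>. Dividing, and using that \<open>\<lambda>\<close> is at least the positive
  number \<open>(c\<^sub>M + \<epsilon>) (\<mu> 1)\<^sup>2\<close>, bounds \<open>U\<^sup>2 + P\<^sup>2\<close> from below (\<open>amplitude_lower_bound\<close>).

  Since \<open>C q\<close> is only Lipschitz, \<open>E\<close> need not be differentiable. Instead of differentiating it, the
  proof freezes the weight at a point \<open>s\<close>: the modified energy is differentiable with
  derivative zero at \<open>s\<close>, and the error is controlled by the Lipschitz constant of the weight.
  The resulting local estimate is chained over \<open>[0, H]\<close> by a bisection argument
  (\<open>exp_comparison_if_local\<close>).

  The passage from the weak formulation to \<open>U\<close>, \<open>P\<close> and \<open>C\<close> rests on one fact: a function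
  on an interval with an integrable weak derivative \<open>v\<close> agrees almost everywhere with a
  primitive of \<open>v\<close> (\<open>weak_deriv_primitive\<close>). It follows from the du Bois-Reymond lemma
  and Fubini's theorem, and needs smooth functions of compact support, which are
  built from \<open>exp (- 1 / x)\<close>.\<close>

section \<open>Smooth cutoff functions on the line\<close>

text \<open>On the line the only partial derivative is the ordinary one. This and the next lemma replace the
  Frechet derivatives in \<open>Ck_on\<close> by it, so that smoothness can be proved by the usual
  induction over derivatives.\<close>

lemma Ck_on_SucI:
  fixes f :: "real \<Rightarrow> real"
  assumes "\<And>x. (f has_real_derivative f' x) (at x)" and "Ck_on n UNIV f'"
  shows "Ck_on (Suc n) UNIV f"
proof -
  have d: "(f has_derivative (\<lambda>h. f' x * h)) (at x)" for x
    using assms(1)[of x] by (simp add: has_field_derivative_def)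
  have "frechet_derivative f (at x) 1 = f' x" for x
    by (simp add: frechet_derivative_at[OF d[of x], symmetric])
  moreover have "f differentiable (at x)" for x
    using d unfolding differentiable_def by blast
  ultimately show ?thesis
    using assms(2) by simp
qed

lemma Ck_on_SucD:
  fixes f :: "real \<Rightarrow> real"
  assumes "Ck_on (Suc n) UNIV f"
  shows "\<exists>f'. (\<forall>x. (f has_real_derivative f' x) (at x)) \<and> Ck_on n UNIV f'"
proof (intro exI conjI allI)
  show "Ck_on n UNIV (\<lambda>x. frechet_derivative f (at x) 1)"
    using assms by simp
  fix x
  have d: "f differentiable (at x)"
    using assms by simp
  have "frechet_derivative f (at x) = (\<lambda>h. frechet_derivative f (at x) 1 * h)"
  proof
    fix h :: real
    have "frechet_derivative f (at x) (h *\<^sub>R 1) = h *\<^sub>R frechet_derivative f (at x) 1"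
      by (rule linear_scale[OF linear_frechet_derivative[OF d]])
    then show "frechet_derivative f (at x) h = frechet_derivative f (at x) 1 * h"
      by (simp add: mult.commute)
  qed
  with frechet_derivative_works[THEN iffD1, OF d]
  show "(f has_real_derivative frechet_derivative f (at x) 1) (at x)"
    unfolding has_field_derivative_def by metis
qed

lemma Ck_on_Suc_imp:
  fixes f :: "real \<Rightarrow> real"
  shows "Ck_on (Suc n) UNIV f \<Longrightarrow> Ck_on n UNIV f"
proof (induction n arbitrary: f)
  case 0
  then show ?case
    by (simp add: continuous_at_imp_continuous_on differentiable_imp_continuous_within)
next
  case (Suc n)
  then show ?case
    by (metis Ck_on_SucI Ck_on_SucD)
qed

lemma Ck_on_add:
  fixes f g :: "real \<Rightarrow> real"
  shows "Ck_on n UNIV f \<Longrightarrow> Ck_on n UNIV g \<Longrightarrow> Ck_on n UNIV (\<lambda>x. f x + g x)"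
proof (induction n arbitrary: f g)
  case 0
  then show ?case by (simp add: continuous_on_add)
next
  case (Suc n)
  obtain f' g' where "\<And>x. (f has_real_derivative f' x) (at x)" "Ck_on n UNIV f'"
    "\<And>x. (g has_real_derivative g' x) (at x)" "Ck_on n UNIV g'"
    using Suc.prems[THEN Ck_on_SucD] by blast
  then show ?case
    by (intro Ck_on_SucI[where f' = "\<lambda>x. f' x + g' x"] Suc.IH DERIV_add)
qed

lemma Ck_on_mult:
  fixes f g :: "real \<Rightarrow> real"
  shows "Ck_on n UNIV f \<Longrightarrow> Ck_on n UNIV g \<Longrightarrow> Ck_on n UNIV (\<lambda>x. f x * g x)"
proof (induction n arbitrary: f g)
  case 0
  then show ?case by (simp add: continuous_on_mult)
next
  case (Suc n)
  obtain f' g' where "\<And>x. (f has_real_derivative f' x) (at x)" "Ck_on n UNIV f'"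
    "\<And>x. (g has_real_derivative g' x) (at x)" "Ck_on n UNIV g'"
    using Suc.prems[THEN Ck_on_SucD] by blast
  moreover have "Ck_on n UNIV f" "Ck_on n UNIV g"
    using Suc.prems Ck_on_Suc_imp by blast+
  ultimately show ?case
    by (intro Ck_on_SucI[where f' = "\<lambda>x. f' x * g x + g' x * f x"] Ck_on_add Suc.IH DERIV_mult)
qed

lemma smooth_on_const: "smooth_on UNIV (\<lambda>x::real. a)"
proof -
  have "Ck_on n UNIV (\<lambda>x::real. a)" for n
  proof (induction n arbitrary: a)
    case (Suc n)
    then show ?case by (intro Ck_on_SucI[where f' = "\<lambda>x. 0"]) auto
  qed simp
  then show ?thesis by (simp add: smooth_on_def)
qed

lemma smooth_on_add:
  fixes f g :: "real \<Rightarrow> real"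
  shows "smooth_on UNIV f \<Longrightarrow> smooth_on UNIV g \<Longrightarrow> smooth_on UNIV (\<lambda>x. f x + g x)"
  unfolding smooth_on_def using Ck_on_add by blast

lemma smooth_on_mult:
  fixes f g :: "real \<Rightarrow> real"
  shows "smooth_on UNIV f \<Longrightarrow> smooth_on UNIV g \<Longrightarrow> smooth_on UNIV (\<lambda>x. f x * g x)"
  unfolding smooth_on_def using Ck_on_mult by blast

lemma smooth_on_antiderivative:
  fixes f :: "real \<Rightarrow> real"
  assumes "\<And>x. (f has_real_derivative f' x) (at x)" and "smooth_on UNIV f'"
  shows "smooth_on UNIV f"
  unfolding smooth_on_def using assms Ck_on_SucI Ck_on_Suc_imp smooth_on_def by metis

lemma smooth_on_derivative:
  fixes f :: "real \<Rightarrow> real"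
  assumes "smooth_on UNIV f"
  shows "(f has_real_derivative frechet_derivative f (at x) 1) (at x)"
    and "continuous_on UNIV (\<lambda>x. frechet_derivative f (at x) 1)"
proof -
  have *: "Ck_on (Suc 0) UNIV f" using assms unfolding smooth_on_def by blast
  then obtain f' where f': "(f has_real_derivative f' x) (at x)" for x
    using Ck_on_SucD by blast
  then have "frechet_derivative f (at x) = (*) (f' x)" for x
    unfolding has_field_derivative_def using frechet_derivative_at by metis
  then show "(f has_real_derivative frechet_derivative f (at x) 1) (at x)"
    using f' by simp
  show "continuous_on UNIV (\<lambda>x. frechet_derivative f (at x) 1)"
    using * by simp
qed

lemma smooth_on_imp_continuous:
  fixes f :: "real \<Rightarrow> real"
  shows "smooth_on UNIV f \<Longrightarrow> continuous_on UNIV f"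
  unfolding smooth_on_def by (metis Ck_on.simps(1))

text \<open>The polynomial factor makes the family closed under differentiation; \<open>p = 1\<close> is the
  classical flat function \<open>exp (- 1 / x)\<close>.\<close>

definition exp_recip :: "real poly \<Rightarrow> real \<Rightarrow> real" where
  "exp_recip p x = (if x > 0 then poly p (inverse x) * exp (- inverse x) else 0)"

lemma poly_mult_exp_minus_tendsto_0:
  fixes p :: "real poly"
  shows "((\<lambda>t. poly p t * exp (- t)) \<longlongrightarrow> 0) at_top"
proof -
  have "((\<lambda>t. \<Sum>i\<le>degree p. coeff p i * (t ^ i / exp t)) \<longlongrightarrow> (\<Sum>i\<le>degree p. coeff p i * 0)) at_top"
    by (intro tendsto_sum tendsto_mult tendsto_const tendsto_power_div_exp_0)
  then show ?thesis
    by (simp add: poly_altdef exp_minus sum_distrib_right divide_inverse mult.assoc)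
qed

text \<open>For \<open>x > 0\<close> the chain rule replaces \<open>p\<close> by \<open>X\<^sup>2 (p - p')\<close>. At zero, the right difference
  quotient is \<open>t p(t) exp (- t)\<close> with \<open>t = 1 / h\<close>, which tends to zero because the exponential beats
  every polynomial.\<close>

lemma exp_recip_has_derivative:
  "(exp_recip p has_real_derivative exp_recip ([:0, 0, 1:] * (p - pderiv p)) x) (at x)"
proof -
  consider "x > 0" | "x < 0" | "x = 0" by linarith
  then show ?thesis
  proof cases
    case 1
    have "((\<lambda>x. poly p (inverse x) * exp (- inverse x)) has_real_derivative
        exp_recip ([:0, 0, 1:] * (p - pderiv p)) x) (at x)"
      using 1 unfolding exp_recip_def
      by (auto intro!: derivative_eq_intros poly_DERIV[THEN DERIV_chain2]
          simp: algebra_simps power2_eq_square)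
    then show ?thesis
      by (rule has_field_derivative_transform_within_open[where S = "{0<..}"])
        (use 1 in \<open>auto simp: exp_recip_def\<close>)
  next
    case 2
    have "((\<lambda>x. 0) has_real_derivative exp_recip ([:0, 0, 1:] * (p - pderiv p)) x) (at x)"
      using 2 by (simp add: exp_recip_def)
    then show ?thesis
      by (rule has_field_derivative_transform_within_open[where S = "{..<0}"])
        (use 2 in \<open>auto simp: exp_recip_def\<close>)
  next
    case 3
    have "((\<lambda>h. exp_recip p h / h) \<longlongrightarrow> 0) (at_right 0)"
    proof (rule Lim_transform_eventually)
      show "((\<lambda>h. poly ([:0, 1:] * p) (inverse h) * exp (- inverse h)) \<longlongrightarrow> 0) (at_right (0::real))"
        by (rule filterlim_compose[OF poly_mult_exp_minus_tendsto_0 filterlim_inverse_at_top_right])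
      show "\<forall>\<^sub>F h in at_right 0.
          poly ([:0, 1:] * p) (inverse h) * exp (- inverse h) = exp_recip p h / h"
        unfolding eventually_at_right_field
        by (intro exI[of _ 1]) (auto simp: exp_recip_def divide_inverse)
    qed
    moreover have "((\<lambda>h. exp_recip p h / h) \<longlongrightarrow> 0) (at_left 0)"
    proof (rule Lim_transform_eventually[OF tendsto_const])
      show "\<forall>\<^sub>F h in at_left 0. 0 = exp_recip p h / h"
        unfolding eventually_at_left_field
        by (intro exI[of _ "-1"]) (auto simp: exp_recip_def)
    qed
    ultimately have "((\<lambda>h. exp_recip p h / h) \<longlongrightarrow> 0) (at 0)"
      by (simp add: filterlim_at_split)
    then show ?thesis
      using 3 by (simp add: DERIV_def exp_recip_def)
  qed
qed

lemma smooth_on_exp_recip_affine: "smooth_on UNIV (\<lambda>x. exp_recip p (s * x + t))"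
proof -
  have *: "((\<lambda>x. exp_recip p (s * x + t)) has_real_derivative
      exp_recip (smult s ([:0, 0, 1:] * (p - pderiv p))) (s * x + t)) (at x)" for p x
  proof -
    have "((\<lambda>x. exp_recip p (s * x + t)) has_real_derivative
      exp_recip ([:0, 0, 1:] * (p - pderiv p)) (s * x + t) * s) (at x)"
      by (rule DERIV_chain2[OF exp_recip_has_derivative]) (auto intro!: derivative_eq_intros)
    moreover have "exp_recip q y * s = exp_recip (smult s q) y" for q y
      by (simp add: exp_recip_def)
    ultimately show ?thesis by metis
  qed
  have "Ck_on n UNIV (\<lambda>x. exp_recip p (s * x + t))" for n
  proof (induction n arbitrary: p)
    case 0
    show ?case
      using DERIV_isCont[OF *] by (auto intro: continuous_at_imp_continuous_on)
  next
    case (Suc n)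
    show ?case by (rule Ck_on_SucI[OF *]) (rule Suc)
  qed
  then show ?thesis by (simp add: smooth_on_def)
qed

text \<open>A support condition in terms of a compact subinterval is easier to combine and to transfer to
  derivatives and primitives than the closure in the definition.\<close>

lemma test_function_Ioo_iff:
  fixes l r :: real
  assumes "l < r"
  shows "test_function {l<..<r} \<psi> \<longleftrightarrow>
    smooth_on UNIV \<psi> \<and> (\<exists>p q. l < p \<and> p < q \<and> q < r \<and> (\<forall>x. x \<notin> {p..q} \<longrightarrow> \<psi> x = 0))"
    (is "?lhs \<longleftrightarrow> ?rhs")
proof
  assume ?rhs
  then obtain p q where s: "smooth_on UNIV \<psi>" and pq: "l < p" "q < r"
    and z: "\<And>x. x \<notin> {p..q} \<Longrightarrow> \<psi> x = 0" by blast
  have "{x. \<psi> x \<noteq> 0} \<subseteq> {p..q}"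
    using z by blast
  then have sub: "closure {x. \<psi> x \<noteq> 0} \<subseteq> {p..q}"
    by (intro closure_minimal) simp_all
  then have "compact (closure {x. \<psi> x \<noteq> 0})"
    by (meson bounded_closed_interval bounded_subset closed_closure compact_eq_bounded_closed)
  then show ?lhs
    unfolding test_function_def using s sub pq by fastforce
next
  assume L: ?lhs
  \<comment> \<open>The two extra points ensure \<open>p < q\<close> also when \<open>\<psi>\<close> vanishes identically.\<close>
  define K where "K = closure {x. \<psi> x \<noteq> 0} \<union> {l + (r - l) / 3, l + 2 * (r - l) / 3}"
  have K: "compact K" "K \<subseteq> {l<..<r}"
    using L assms unfolding K_def test_function_def by (auto simp: field_simps)
  have i: "K \<noteq> {}" unfolding K_def by simp
  obtain p q where p: "p \<in> K" "\<And>x. x \<in> K \<Longrightarrow> p \<le> x" and q: "q \<in> K" "\<And>x. x \<in> K \<Longrightarrow> x \<le> q"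
    using compact_attains_inf[OF K(1) i] compact_attains_sup[OF K(1) i] by metis
  have "l + (r - l) / 3 \<in> K" "l + 2 * (r - l) / 3 \<in> K" unfolding K_def by auto
  then have "p \<le> l + (r - l) / 3" "l + 2 * (r - l) / 3 \<le> q" using p q by blast+
  then have "p < q" using assms by (simp add: field_simps)
  moreover have "\<psi> x = 0" if "x \<notin> {p..q}" for x
  proof (rule ccontr)
    assume "\<psi> x \<noteq> 0"
    then have "x \<in> K" unfolding K_def using closure_subset[of "{x. \<psi> x \<noteq> 0}"] by blast
    with p q that show False by auto
  qed
  moreover have "l < p" "q < r"
    using p(1) q(1) K(2) by auto
  ultimately show ?rhs
    using L unfolding test_function_def by blast
qed

text \<open>As \<open>n\<close> grows, the two factors \<open>exp (- 1 / (n (x - a)))\<close> and \<open>exp (- 1 / (n (b - x)))\<close> tend to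
  one inside the interval, while the support stays in \<open>[a, b]\<close> and the values stay in \<open>[0, 1]\<close>, so
  that dominated convergence turns tests against smooth functions into tests against
  indicator functions.\<close>

definition smooth_step :: "real \<Rightarrow> real \<Rightarrow> nat \<Rightarrow> real \<Rightarrow> real" where
  "smooth_step a b n x = exp_recip 1 (real n * x + - (real n * a)) * exp_recip 1 (- real n * x + real n * b)"

lemma smooth_step_bounds: "0 \<le> smooth_step a b n x" "smooth_step a b n x \<le> 1"
  unfolding smooth_step_def exp_recip_def by (auto intro!: mult_le_one)

lemma smooth_step_outside: "x \<notin> {a<..<b} \<Longrightarrow> smooth_step a b n x = 0"
proof -
  assume "x \<notin> {a<..<b}"
  then have "real n * x + - (real n * a) \<le> 0 \<or> - real n * x + real n * b \<le> 0"
    by (auto simp: mult_left_mono not_less)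
  then show ?thesis unfolding smooth_step_def exp_recip_def by auto
qed

lemma smooth_step_tendsto: "(\<lambda>n. smooth_step a b n x) \<longlonglongrightarrow> indicator {a<..<b} x"
proof (cases "x \<in> {a<..<b}")
  case True
  have *: "(\<lambda>n. exp_recip 1 (real n * t)) \<longlonglongrightarrow> 1" if "t > 0" for t
  proof (rule Lim_transform_eventually)
    have "(\<lambda>n. exp (- (inverse (real n) * inverse t))) \<longlonglongrightarrow> exp (- (0 * inverse t))"
      by (intro tendsto_intros lim_inverse_n)
    then show "(\<lambda>n. exp (- inverse (real n * t))) \<longlonglongrightarrow> 1" by simp
    show "\<forall>\<^sub>F n in sequentially. exp (- inverse (real n * t)) = exp_recip 1 (real n * t)"
      using eventually_gt_at_top[of 0]
      by eventually_elim (use that in \<open>simp add: exp_recip_def\<close>)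
  qed
  have "(\<lambda>n. exp_recip 1 (real n * (x - a)) * exp_recip 1 (real n * (b - x))) \<longlonglongrightarrow> 1 * 1"
    using True by (intro tendsto_mult *) auto
  then show ?thesis
    using True by (simp add: smooth_step_def algebra_simps)
qed (simp add: smooth_step_outside)

lemma test_function_smooth_step:
  assumes "l < a" "a < b" "b < r"
  shows "test_function {l<..<r} (smooth_step a b n)"
proof -
  have "smooth_on UNIV (smooth_step a b n)"
    unfolding smooth_step_def by (intro smooth_on_mult smooth_on_exp_recip_affine)
  moreover have "\<forall>x. x \<notin> {a..b} \<longrightarrow> smooth_step a b n x = 0"
    using smooth_step_outside by auto
  ultimately show ?thesis
    using assms by (subst test_function_Ioo_iff) auto
qed

section \<open>Weak derivatives in one variable\<close>

text \<open>The sets over which \<open>g\<close> has integral zero form a Dynkin system that contains the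
  intersection-stable family of open rays, hence all Borel sets.\<close>

lemma AE_zero_if_ray_integrals_zero:
  fixes g :: "real \<Rightarrow> real"
  assumes g: "integrable lborel g" and total: "(LINT t|lborel. g t) = 0"
    and ray: "\<And>x. (LINT t|lborel. indicator {..<x} t * g t) = 0"
  shows "AE x in lborel. g x = 0"
proof (rule sigma_finite_measure.density_zero[OF lborel.sigma_finite_measure_axioms g])
  fix A :: "real set"
  assume "A \<in> sets lborel"
  then have A: "A \<in> sigma_sets UNIV (range lessThan)"
    by (simp add: borel_Iio)
  have meas: "B \<in> sets lborel" if "B \<in> sigma_sets UNIV (range lessThan)" for B :: "real set"
    using that by (simp add: borel_Iio)
  have int: "integrable lborel (\<lambda>t. indicator B t *\<^sub>R g t)" if "B \<in> sets lborel" for B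
    by (rule integrable_mult_indicator[OF that g])
  have "Int_stable (range (lessThan :: real \<Rightarrow> real set))"
    by (auto simp: Int_stable_def greaterThan_Int_greaterThan lessThan_Int_lessThan)
  then show "set_lebesgue_integral lborel A g = 0"
    using subset_UNIV[of "range lessThan", folded Pow_UNIV] A
  proof (induction rule: sigma_sets_induct_disjoint)
    case (basic A)
    then show ?case using ray by (auto simp: set_lebesgue_integral_def)
  next
    case (compl A)
    have "set_lebesgue_integral lborel (UNIV - A) g
        = (LINT t|lborel. g t - indicator A t *\<^sub>R g t)"
      unfolding set_lebesgue_integral_def
      by (intro Bochner_Integration.integral_cong) (auto simp: indicator_def)
    also have "\<dots> = 0"
      using compl total int[OF meas[OF compl(1)]] g by (simp add: set_lebesgue_integral_def)
    finally show ?case .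
  next
    case (union A)
    then have m: "A i \<in> sets lborel" for i by (intro meas) auto
    have "set_lebesgue_integral lborel (\<Union>i. A i) g = (\<Sum>i. set_lebesgue_integral lborel (A i) g)"
    proof (rule lebesgue_integral_countable_add)
      show "set_integrable lborel (\<Union>i. A i) g"
        unfolding set_integrable_def using m by (intro int) auto
    qed (use m union(1) in \<open>auto simp: disjoint_family_on_def\<close>)
    then show ?case using union by simp
  qed (auto simp: set_lebesgue_integral_def)
qed

lemma integrable_lebesgue_borel_version:
  fixes f :: "'a::euclidean_space \<Rightarrow> real"
  assumes "integrable lebesgue f"
  obtains g where "g \<in> borel_measurable borel" "integrable lborel g" "AE x in lebesgue. f x = g x"
proof -
  obtain g where g: "g \<in> borel_measurable lborel" and ae: "AE x in lborel. f x = g x"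
    using completion_ex_borel_measurable_real[OF borel_measurable_integrable[OF assms]] by auto
  have ae': "AE x in lebesgue. f x = g x" using ae by (rule AE_completion)
  have "integrable lebesgue g"
    using assms integrable_cong_AE_imp[OF assms _ ] ae' measurable_completion[OF g] 
    by (metis (mono_tags, lifting) AE_cong)
  then show thesis
    using g ae' that by (simp add: integrable_completion)
qed

lemma integrable_lebesgue_on_iff:
  fixes f :: "'a::euclidean_space \<Rightarrow> real"
  assumes "S \<in> sets lebesgue"
  shows "integrable (lebesgue_on S) f \<longleftrightarrow> integrable lebesgue (\<lambda>x. indicator S x * f x)"
  using integrable_restrict_space[of S lebesgue f] assms by simp

lemma integral_lebesgue_on_eq:
  fixes f :: "'a::euclidean_space \<Rightarrow> real"
  assumes "S \<in> sets lebesgue"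
  shows "(LINT x|lebesgue_on S. f x) = (LINT x|lebesgue. indicator S x * f x)"
  using integral_restrict_space[of S lebesgue f] assms by simp

lemma AE_lebesgue_on_iff:
  assumes "S \<in> sets lebesgue"
  shows "(AE x in lebesgue_on S. P x) \<longleftrightarrow> (AE x in lebesgue. x \<in> S \<longrightarrow> P x)"
  using assms by (simp add: AE_restrict_space_iff)

lemma lebesgue_measurable_indicator_times:
  fixes f :: "real \<Rightarrow> real"
  assumes "f \<in> borel_measurable lebesgue" "A \<in> sets borel"
  shows "(\<lambda>x. indicator A x * f x) \<in> borel_measurable lebesgue"
  by (rule borel_measurable_times[OF borel_measurable_indicator assms(1)]) (use assms(2) in simp)

lemma loc_integrable_Icc:
  fixes w :: "real \<Rightarrow> real"
  assumes "loc_integrable S w" "{p..q} \<subseteq> S"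
  shows "integrable lebesgue (\<lambda>x. indicator {p..q} x * w x)"
  using assms by (simp add: loc_integrable_def integrable_lebesgue_on_iff[symmetric])

text \<open>Testing with \<open>smooth_step\<close> and passing to the limit shows that \<open>w\<close> has integral zero over every
  compactly contained open interval. On each of these intervals the previous criterion applies
  to a Borel version of \<open>w\<close>, and countably many of them exhaust \<open>{l<..<r}\<close>.\<close>

lemma AE_zero_if_weakly_zero:
  fixes w :: "real \<Rightarrow> real"
  assumes "l < r" and w: "loc_integrable {l<..<r} w"
    and zero: "\<And>\<psi>. test_function {l<..<r} \<psi> \<Longrightarrow> (LINT x|lebesgue_on {l<..<r}. w x * \<psi> x) = 0"
  shows "AE x in lebesgue_on {l<..<r}. w x = 0"
proof -
  have Ioo: "integrable lebesgue (\<lambda>x. indicator {a<..<b} x * w x)"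
    and interval: "(LINT x|lebesgue. indicator {a<..<b} x * w x) = 0"
    if ab: "l < a" "a < b" "b < r" for a b
  proof -
    have wi: "integrable lebesgue (\<lambda>x. indicator {a..b} x * w x)"
      using ab by (intro loc_integrable_Icc[OF w]) auto
    have eq: "indicator {a<..<b} x * w x = indicator {a<..<b} x * (indicator {a..b} x * w x)" for x
      by (auto simp: indicator_def)
    show "integrable lebesgue (\<lambda>x. indicator {a<..<b} x * w x)"
      unfolding eq using integrable_mult_indicator[OF _ wi, of "{a<..<b}"] by simp
    have cont: "smooth_step a b n \<in> borel_measurable lebesgue" for n
      using test_function_smooth_step[OF ab] smooth_on_imp_continuous
      by (intro measurable_completion) (auto simp: test_function_def intro: borel_measurable_continuous_onI)
    have "(\<lambda>n. LINT x|lebesgue. (indicator {a..b} x * w x) * smooth_step a b n x)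
        \<longlonglongrightarrow> (LINT x|lebesgue. (indicator {a..b} x * w x) * indicator {a<..<b} x)"
    proof (rule integral_dominated_convergence[where w = "\<lambda>x. \<bar>indicator {a..b} x * w x\<bar>"])
      show "AE x in lebesgue. (\<lambda>n. (indicator {a..b} x * w x) * smooth_step a b n x)
          \<longlonglongrightarrow> (indicator {a..b} x * w x) * indicator {a<..<b} x"
        by (intro AE_I2 tendsto_mult tendsto_const smooth_step_tendsto)
      show "AE x in lebesgue. norm ((indicator {a..b} x * w x) * smooth_step a b n x)
          \<le> \<bar>indicator {a..b} x * w x\<bar>" for n
        using smooth_step_bounds[of a b n] by (intro AE_I2) (auto simp: abs_mult intro: mult_right_le_one_le)
    next
      show "(\<lambda>x. indicator {a..b} x * w x * indicator {a<..<b} x) \<in> borel_measurable lebesgue"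
        using borel_measurable_integrable[OF wi] by (rule borel_measurable_times) (auto intro!: borel_measurable_indicator)
    qed (use wi cont in \<open>auto intro!: borel_measurable_times borel_measurable_integrable[OF wi]\<close>)
    moreover have "(LINT x|lebesgue. (indicator {a..b} x * w x) * smooth_step a b n x) = 0" for n
    proof -
      have "(LINT x|lebesgue. (indicator {a..b} x * w x) * smooth_step a b n x)
          = (LINT x|lebesgue. indicator {l<..<r} x * (w x * smooth_step a b n x))"
      proof (intro Bochner_Integration.integral_cong refl)
        fix x
        show "(indicator {a..b} x * w x) * smooth_step a b n x
            = indicator {l<..<r} x * (w x * smooth_step a b n x)"
          using ab by (cases "x \<in> {a<..<b}") (auto simp: smooth_step_outside)
      qed
      also have "\<dots> = 0"
        using zero[OF test_function_smooth_step[OF ab]] by (simp add: integral_lebesgue_on_eq)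
      finally show ?thesis .
    qed
    ultimately have "(LINT x|lebesgue. (indicator {a..b} x * w x) * indicator {a<..<b} x) = 0"
      by (simp add: LIMSEQ_const_iff)
    then show "(LINT x|lebesgue. indicator {a<..<b} x * w x) = 0"
      by (subst (asm) mult.commute) (simp only: eq[symmetric])
  qed
  have sub: "AE x in lebesgue. indicator {p<..<q} x * w x = 0" if pq: "l < p" "p < q" "q < r" for p q
  proof -
    obtain g where g: "g \<in> borel_measurable borel" "integrable lborel g"
      and ae: "AE x in lebesgue. indicator {p<..<q} x * w x = g x"
      using integrable_lebesgue_borel_version[OF Ioo[OF pq]] .
    have gm [measurable]: "g \<in> borel_measurable lebesgue"
      using g(1) by (intro measurable_completion) simp
    have wm: "(\<lambda>x. indicator {p<..<q} x * w x) \<in> borel_measurable lebesgue"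
      using Ioo[OF pq] by simp
    have ray: "(LINT t|lborel. indicator {..<x} t * g t) = 0" for x
    proof -
      have "(LINT t|lborel. indicator {..<x} t * g t) = (LINT t|lebesgue. indicator {..<x} t * g t)"
        using g(1) by (intro integral_completion[symmetric]) simp
      also have "\<dots> = (LINT t|lebesgue. indicator {..<x} t * (indicator {p<..<q} t * w t))"
        using ae by (intro integral_cong_AE lebesgue_measurable_indicator_times wm gm) auto
      also have "\<dots> = (LINT t|lebesgue. indicator {p<..<min x q} t * w t)"
        by (intro Bochner_Integration.integral_cong) (auto simp: indicator_def)
      also have "\<dots> = 0"
        using interval[of p "min x q"] pq by (cases "p < min x q") auto
      finally show ?thesis .
    qed
    have "(LINT t|lborel. g t) = (LINT t|lebesgue. g t)"
      using g(1) by (intro integral_completion[symmetric]) simp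
    also have "\<dots> = (LINT t|lebesgue. indicator {p<..<q} t * w t)"
      using ae by (intro integral_cong_AE wm) auto
    finally have "AE x in lborel. g x = 0"
      using ray g(2) interval[OF pq] by (intro AE_zero_if_ray_integrals_zero) auto
    then have "AE x in lebesgue. g x = 0" by (rule AE_completion)
    with ae show ?thesis by eventually_elim simp
  qed
  define d where "d n = (r - l) / (real n + 3)" for n
  have d: "l < l + d n" "l + d n < r - d n" "r - d n < r" for n
  proof -
    have "0 < d n" using \<open>l < r\<close> unfolding d_def by simp
    moreover have "d n \<le> (r - l) / 3"
      using \<open>l < r\<close> divide_left_mono[of 3 "real n + 3" "r - l"] unfolding d_def by simp
    then have "3 * d n \<le> r - l" by simp
    ultimately show "l < l + d n" and "l + d n < r - d n" and "r - d n < r"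
      by auto
  qed
  have "AE x in lebesgue. \<forall>n. indicator {l + d n<..<r - d n} x * w x = 0"
    using sub[OF d] by (subst AE_all_countable) auto
  then have "AE x in lebesgue. x \<in> {l<..<r} \<longrightarrow> w x = 0"
  proof eventually_elim
    case (elim x)
    show ?case
    proof
      assume x: "x \<in> {l<..<r}"
      have "d \<longlonglongrightarrow> 0"
        unfolding d_def by real_asymp
      then have "\<forall>\<^sub>F n in sequentially. d n < min (x - l) (r - x)"
        using x by (intro order_tendstoD) auto
      then obtain n where "d n < min (x - l) (r - x)"
        by (auto simp: eventually_sequentially)
      then have "x \<in> {l + d n<..<r - d n}" by auto
      with elim show "w x = 0"
        by (metis indicator_simps(1) mult_1)
    qed
  qed
  then show ?thesis by (simp add: AE_lebesgue_on_iff)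
qed

lemma integrable_lebesgue_on_subset:
  fixes f :: "'a::euclidean_space \<Rightarrow> real"
  assumes "integrable (lebesgue_on T) f" "S \<subseteq> T" "S \<in> sets lebesgue" "T \<in> sets lebesgue"
  shows "integrable (lebesgue_on S) f"
proof -
  have "integrable lebesgue (\<lambda>x. indicator T x * f x)"
    using assms by (simp add: integrable_lebesgue_on_iff)
  from integrable_mult_indicator[OF assms(3) this]
  have "integrable lebesgue (\<lambda>x. indicator S x * (indicator T x * f x))" by simp
  also have "(\<lambda>x. indicator S x * (indicator T x * f x)) = (\<lambda>x. indicator S x * f x)"
    using assms(2) by (intro ext) (auto split: split_indicator)
  finally show ?thesis using assms by (simp add: integrable_lebesgue_on_iff)
qed

lemma loc_integrable_if_integrable:
  assumes "integrable (lebesgue_on T) f" "S \<subseteq> T" "T \<in> sets lebesgue"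
  shows "loc_integrable S f"
  unfolding loc_integrable_def
  using assms by (auto intro!: integrable_lebesgue_on_subset[OF assms(1)] simp: compact_imp_closed)

lemma loc_integrable_continuous:
  fixes f :: "real \<Rightarrow> real"
  assumes "continuous_on {l..r} f"
  shows "loc_integrable {l<..<r} f"
  by (rule loc_integrable_if_integrable[OF continuous_imp_integrable_real[OF assms]]) auto

lemma loc_integrable_add_cmult:
  assumes "loc_integrable S f" "loc_integrable S g"
  shows "loc_integrable S (\<lambda>x. f x + a * g x)"
  using assms unfolding loc_integrable_def by auto

lemma test_function_add_cmult:
  fixes l r :: real
  assumes "l < r" and f: "test_function {l<..<r} f" and g: "test_function {l<..<r} g"
  shows "test_function {l<..<r} (\<lambda>x. f x + a * g x)"
proof -
  obtain p q where pq: "l < p" "p < q" "q < r" "\<And>x. x \<notin> {p..q} \<Longrightarrow> f x = 0"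
    using f unfolding test_function_Ioo_iff[OF \<open>l < r\<close>] by blast
  obtain p' q' where pq': "l < p'" "p' < q'" "q' < r" "\<And>x. x \<notin> {p'..q'} \<Longrightarrow> g x = 0"
    using g unfolding test_function_Ioo_iff[OF \<open>l < r\<close>] by blast
  have "f x + a * g x = 0" if "x \<notin> {min p p'..max q q'}" for x
  proof -
    have "x \<notin> {p..q}" "x \<notin> {p'..q'}" using that by auto
    then have "f x = 0" "g x = 0" using pq(4) pq'(4) by blast+
    then show ?thesis by simp
  qed
  moreover have "l < min p p'" "min p p' < max q q'" "max q q' < r"
    using pq pq' by auto
  moreover have "smooth_on UNIV (\<lambda>x. f x + a * g x)"
    using f g unfolding test_function_def by (intro smooth_on_add smooth_on_mult smooth_on_const) auto
  ultimately show ?thesis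
    unfolding test_function_Ioo_iff[OF \<open>l < r\<close>] by blast
qed

lemma test_function_derivative:
  fixes l r :: real
  assumes "l < r" and \<phi>: "test_function {l<..<r} \<phi>"
  shows "test_function {l<..<r} (\<lambda>x. frechet_derivative \<phi> (at x) 1)"
proof -
  obtain p q where pq: "l < p" "p < q" "q < r" "\<And>x. x \<notin> {p..q} \<Longrightarrow> \<phi> x = 0"
    and s: "smooth_on UNIV \<phi>"
    using \<phi> unfolding test_function_Ioo_iff[OF \<open>l < r\<close>] by blast
  have "Ck_on n UNIV (\<lambda>x. frechet_derivative \<phi> (at x) 1)" for n
  proof -
    have "Ck_on (Suc n) UNIV \<phi>" using s unfolding smooth_on_def by blast
    then show ?thesis by simp
  qed
  moreover have "frechet_derivative \<phi> (at x) 1 = 0" if "x \<notin> {p..q}" for x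
  proof -
    have "((\<lambda>x. 0) has_real_derivative frechet_derivative \<phi> (at x) 1) (at x)"
      by (rule has_field_derivative_transform_within_open[OF smooth_on_derivative(1)[OF s],
            where S = "- {p..q}"]) (use that pq in auto)
    then show ?thesis
      using DERIV_unique DERIV_const by blast
  qed
  ultimately show ?thesis
    unfolding test_function_Ioo_iff[OF \<open>l < r\<close>] smooth_on_def using pq by blast
qed

text \<open>The mean value condition is what makes the primitive vanish to the right of the support.\<close>

lemma test_function_antiderivative:
  fixes l r :: real
  assumes "l < r" and \<eta>: "test_function {l<..<r} \<eta>" and mean: "(LINT x|lebesgue_on {l<..<r}. \<eta> x) = 0"
  obtains \<phi> where "test_function {l<..<r} \<phi>" "\<And>x. frechet_derivative \<phi> (at x) 1 = \<eta> x"
proof -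
  obtain p q where pq: "l < p" "p < q" "q < r" "\<And>x. x \<notin> {p..q} \<Longrightarrow> \<eta> x = 0"
    and s: "smooth_on UNIV \<eta>"
    using \<eta> unfolding test_function_Ioo_iff[OF \<open>l < r\<close>] by blast
  have cont: "continuous_on A \<eta>" for A
    using smooth_on_imp_continuous[OF s] continuous_on_subset by blast
  have "(\<lambda>x. indicator {l<..<r} x * \<eta> x) = (\<lambda>x. indicator {p..q} x * \<eta> x)"
  proof
    fix x show "indicator {l<..<r} x * \<eta> x = indicator {p..q} x * \<eta> x"
      using pq by (cases "x \<in> {p..q}") (auto simp: pq(4))
  qed
  then have "(LINT x|lebesgue_on {p..q}. \<eta> x) = 0"
    using mean by (simp add: integral_lebesgue_on_eq)
  then have I: "(\<eta> has_integral 0) {p..q}"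
    using has_integral_integral_lebesgue_on[OF continuous_imp_integrable_real[OF cont], of p q] by simp
  \<comment> \<open>Starting at \<open>l - 1\<close> keeps the support away from the end point, where the
    derivative of the integral would only be one-sided.\<close>
  define \<phi> where "\<phi> x = integral {l - 1..x} \<eta>" for x
  have left: "\<phi> x = 0" if "x < p" for x
    unfolding \<phi>_def by (rule integral_unique, rule has_integral_is_0) (use that pq(4) in auto)
  have right: "\<phi> x = 0" if "x > q" for x
    unfolding \<phi>_def
    by (rule integral_unique, rule has_integral_on_superset[OF I]) (use that pq in auto)
  have deriv: "(\<phi> has_real_derivative \<eta> x) (at x)" for x
  proof (cases "x < p")
    case True
    have "((\<lambda>x. 0) has_real_derivative \<eta> x) (at x)"
      using True pq(4)[of x] by simp
    then show ?thesis
      by (rule has_field_derivative_transform_within_open[where S = "{..<p}"]) (use True left in auto)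
  next
    case False
    then have "(\<phi> has_real_derivative \<eta> x) (at x within {l - 1..x + 1})"
      unfolding \<phi>_def using pq by (intro integral_has_real_derivative cont) auto
    then show ?thesis
      using False pq by (simp add: at_within_Icc_at)
  qed
  have "test_function {l<..<r} \<phi>"
    unfolding test_function_Ioo_iff[OF \<open>l < r\<close>]
  proof
    show "smooth_on UNIV \<phi>" by (rule smooth_on_antiderivative[OF deriv s])
    have "\<phi> x = 0" if "x \<notin> {p..q}" for x using that left right by force
    then show "\<exists>p q. l < p \<and> p < q \<and> q < r \<and> (\<forall>x. x \<notin> {p..q} \<longrightarrow> \<phi> x = 0)"
      using pq by blast
  qed
  moreover have "frechet_derivative \<phi> (at x) 1 = \<eta> x" for x
  proof -
    have "(\<phi> has_derivative (*) (\<eta> x)) (at x)"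
      using deriv by (simp add: has_field_derivative_def)
    from frechet_derivative_at[OF this, symmetric] show ?thesis by simp
  qed
  ultimately show thesis using that by blast
qed

lemma test_function_times_loc_integrable:
  fixes w :: "real \<Rightarrow> real"
  assumes "l < r" and w: "loc_integrable {l<..<r} w" and \<psi>: "test_function {l<..<r} \<psi>"
  shows "integrable (lebesgue_on {l<..<r}) (\<lambda>x. w x * \<psi> x)"
proof -
  obtain p q where pq: "l < p" "p < q" "q < r" "\<And>x. x \<notin> {p..q} \<Longrightarrow> \<psi> x = 0"
    and s: "smooth_on UNIV \<psi>"
    using \<psi> unfolding test_function_Ioo_iff[OF \<open>l < r\<close>] by blast
  have cont: "continuous_on UNIV \<psi>"
    using smooth_on_imp_continuous[OF s] .
  obtain B where B: "\<And>x. x \<in> {p..q} \<Longrightarrow> \<bar>\<psi> x\<bar> \<le> B"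
    using compact_imp_bounded[OF compact_continuous_image[OF continuous_on_subset[OF cont subset_UNIV] compact_Icc[of p q]]]
    unfolding bounded_iff by (metis image_eqI real_norm_def)
  have wi: "integrable lebesgue (\<lambda>x. indicator {p..q} x * w x)"
    using pq by (intro loc_integrable_Icc[OF w]) auto
  have eq: "indicator {l<..<r} x * (w x * \<psi> x) = indicator {p..q} x * w x * \<psi> x" for x
    using pq by (cases "x \<in> {p..q}") (auto simp: pq(4))
  have \<psi>m: "\<psi> \<in> borel_measurable lebesgue"
    using cont by (intro measurable_completion) (auto intro: borel_measurable_continuous_onI)
  have "integrable lebesgue (\<lambda>x. indicator {p..q} x * w x * \<psi> x)"
  proof (rule Bochner_Integration.integrable_bound)
    show "integrable lebesgue (\<lambda>x. B * (indicator {p..q} x * w x))"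
      by (rule integrable_mult_right[OF wi])
    show "(\<lambda>x. indicator {p..q} x * w x * \<psi> x) \<in> borel_measurable lebesgue"
      by (rule borel_measurable_times[OF borel_measurable_integrable[OF wi] \<psi>m])
    show "AE x in lebesgue. norm (indicator {p..q} x * w x * \<psi> x) \<le> norm (B * (indicator {p..q} x * w x))"
    proof (rule AE_I2)
      fix x
      have "\<bar>\<psi> x\<bar> * \<bar>w x\<bar> \<le> \<bar>B\<bar> * \<bar>w x\<bar>" if "x \<in> {p..q}"
        using B[OF that] by (intro mult_right_mono) auto
      then show "norm (indicator {p..q} x * w x * \<psi> x) \<le> norm (B * (indicator {p..q} x * w x))"
        by (cases "x \<in> {p..q}") (auto simp: abs_mult mult_ac)
    qed
  qed
  then show ?thesis
    by (simp add: integrable_lebesgue_on_iff eq)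
qed

text \<open>Fix a test function \<open>\<psi>0\<close> with nonzero integral \<open>m\<close>. For every test function \<open>\<psi>\<close>, subtracting a
  multiple of \<open>\<psi>0\<close> gives a function of mean zero, which is the derivative of a test function; the
  hypothesis for it says that \<open>w - C\<close> annihilates \<open>\<psi>\<close>, where \<open>C\<close> is the integral of \<open>w\<close>
  against \<open>\<psi>0 / m\<close>.\<close>

lemma du_Bois_Reymond:
  fixes w :: "real \<Rightarrow> real"
  assumes "l < r" and w: "loc_integrable {l<..<r} w"
    and zero: "\<And>\<phi>. test_function {l<..<r} \<phi> \<Longrightarrow>
      (LINT x|lebesgue_on {l<..<r}. w x * frechet_derivative \<phi> (at x) 1) = 0"
  obtains C where "AE x in lebesgue_on {l<..<r}. w x = C"
proof -
  let ?M = "lebesgue_on {l<..<r}"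
  have one: "loc_integrable {l<..<r} (\<lambda>x. 1)"
    by (rule loc_integrable_continuous) simp
  have int: "integrable ?M \<psi>" if "test_function {l<..<r} \<psi>" for \<psi>
    using test_function_times_loc_integrable[OF \<open>l < r\<close> one that] by simp
  note wint = test_function_times_loc_integrable[OF \<open>l < r\<close> w]
  \<comment> \<open>Otherwise the constant \<open>1\<close> would be weakly zero.\<close>
  have "\<exists>\<psi>. test_function {l<..<r} \<psi> \<and> (LINT x|?M. \<psi> x) \<noteq> 0"
  proof (rule ccontr)
    assume "\<not> ?thesis"
    then have "AE x in ?M. (1::real) = 0"
      by (intro AE_zero_if_weakly_zero[OF \<open>l < r\<close> one]) auto
    then have "ae_filter ?M = bot"
      by (simp add: eventually_False[symmetric])
    then have "emeasure ?M (space ?M) = 0"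
      by (simp only: ae_filter_eq_bot_iff)
    then show False
      using \<open>l < r\<close> by (simp add: emeasure_restrict_space)
  qed
  then obtain \<psi>0 where \<psi>0: "test_function {l<..<r} \<psi>0" and nz: "(LINT x|?M. \<psi>0 x) \<noteq> 0"
    by blast
  define m where "m = (LINT x|?M. \<psi>0 x)"
  define C where "C = (LINT x|?M. w x * \<psi>0 x) / m"
  have "AE x in ?M. w x + (- C) * 1 = 0"
  proof (rule AE_zero_if_weakly_zero[OF \<open>l < r\<close> loc_integrable_add_cmult[OF w one]])
    fix \<psi> assume \<psi>: "test_function {l<..<r} \<psi>"
    define k where "k = (LINT x|?M. \<psi> x) / m"
    have \<eta>: "test_function {l<..<r} (\<lambda>x. \<psi> x + (- k) * \<psi>0 x)"
      by (rule test_function_add_cmult[OF \<open>l < r\<close> \<psi> \<psi>0])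
    have "(LINT x|?M. \<psi> x + (- k) * \<psi>0 x) = (LINT x|?M. \<psi> x) + (- k) * m"
      using int[OF \<psi>] int[OF \<psi>0] unfolding m_def by simp
    also have "\<dots> = 0" using nz unfolding k_def m_def by simp
    finally obtain \<phi> where \<phi>: "test_function {l<..<r} \<phi>"
      "\<And>x. frechet_derivative \<phi> (at x) 1 = \<psi> x + (- k) * \<psi>0 x"
      using test_function_antiderivative[OF \<open>l < r\<close> \<eta>] by blast
    have "0 = (LINT x|?M. w x * (\<psi> x + (- k) * \<psi>0 x))"
      using zero[OF \<phi>(1)] by (simp add: \<phi>(2))
    also have "\<dots> = (LINT x|?M. w x * \<psi> x + (- k) * (w x * \<psi>0 x))"
      by (simp add: algebra_simps)
    also have "\<dots> = (LINT x|?M. w x * \<psi> x) + (- k) * (LINT x|?M. w x * \<psi>0 x)"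
      using wint[OF \<psi>] wint[OF \<psi>0] by simp
    also have "\<dots> = (LINT x|?M. w x * \<psi> x) + (- C) * (LINT x|?M. \<psi> x)"
      unfolding C_def k_def by simp
    also have "\<dots> = (LINT x|?M. w x * \<psi> x + (- C) * \<psi> x)"
      using wint[OF \<psi>] int[OF \<psi>] by simp
    also have "\<dots> = (LINT x|?M. (w x + (- C) * 1) * \<psi> x)"
      by (simp add: algebra_simps)
    finally show "(LINT x|?M. (w x + (- C) * 1) * \<psi> x) = 0" by simp
  qed
  then have "AE x in ?M. w x = C" by eventually_elim simp
  then show thesis by (rule that)
qed

text \<open>The primitive of \<open>v\<close> is only absolutely continuous, so this is proved by Fubini's theorem for
  \<open>v(t) \<phi>'(x)\<close> on the triangle \<open>t < x\<close>: integrating over \<open>t\<close> first gives the left side, and integrating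
  over \<open>x\<close> first gives \<open>- \<phi>(t)\<close>, because \<open>\<phi>\<close> vanishes near \<open>r\<close>.\<close>

lemma weak_integration_by_parts:
  fixes v :: "real \<Rightarrow> real"
  assumes "l < r" and v: "integrable (lebesgue_on {l<..<r}) v" and \<phi>: "test_function {l<..<r} \<phi>"
  shows "(LINT x|lebesgue_on {l<..<r}. integral {l..x} v * frechet_derivative \<phi> (at x) 1)
       = - (LINT x|lebesgue_on {l<..<r}. v x * \<phi> x)"
proof -
  define D where "D x = frechet_derivative \<phi> (at x) 1" for x
  obtain p q where pq: "l < p" "p < q" "q < r" "\<And>x. x \<notin> {p..q} \<Longrightarrow> \<phi> x = 0"
    and s: "smooth_on UNIV \<phi>"
    using \<phi> unfolding test_function_Ioo_iff[OF \<open>l < r\<close>] by blast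
  have D': "test_function {l<..<r} D"
    unfolding D_def by (rule test_function_derivative[OF \<open>l < r\<close> \<phi>])
  have deriv: "(\<phi> has_real_derivative D x) (at x)" for x
    unfolding D_def by (rule smooth_on_derivative(1)[OF s])
  have Dcont: "continuous_on UNIV D"
    unfolding D_def by (rule smooth_on_derivative(2)[OF s])
  have Dm [measurable]: "D \<in> borel_measurable borel"
    using Dcont by (rule borel_measurable_continuous_onI)
  have \<phi>m [measurable]: "\<phi> \<in> borel_measurable borel"
    using smooth_on_imp_continuous[OF s] by (rule borel_measurable_continuous_onI)
  have Dout: "D x = 0" if "x \<notin> {l<..<r}" for x
    using D' that unfolding test_function_Ioo_iff[OF \<open>l < r\<close>] by force
  have one: "loc_integrable {l<..<r} (\<lambda>x. 1)"
    by (rule loc_integrable_continuous) simp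
  have indD: "indicator {l<..<r} x * D x = D x" for x
    using Dout by (cases "x \<in> {l<..<r}") auto
  have Dint: "integrable lborel D"
    using test_function_times_loc_integrable[OF \<open>l < r\<close> one D']
    by (simp add: integrable_lebesgue_on_iff indD integrable_completion)
  have fi: "integrable lebesgue (\<lambda>x. indicator {l<..<r} x * v x)"
    using v by (simp add: integrable_lebesgue_on_iff)
  obtain g where gm [measurable]: "g \<in> borel_measurable borel" and g: "integrable lborel g"
    and ae: "AE x in lebesgue. indicator {l<..<r} x * v x = g x"
    using integrable_lebesgue_borel_version[OF fi] .
  have prim: "integral {l..x} v = (LINT t|lborel. (if t < x then g t else 0))" if x: "x \<in> {l<..<r}" for x
  proof -
    have "integrable (lebesgue_on {l<..<x}) v"
      using x by (intro integrable_lebesgue_on_subset[OF v]) auto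
    then have "integral {l<..<x} v = (LINT t|lebesgue_on {l<..<x}. v t)"
      by (simp add: lebesgue_integral_eq_integral)
    also have "\<dots> = (LINT t|lebesgue. indicator {l<..<x} t * v t)"
      by (simp add: integral_lebesgue_on_eq)
    also have "\<dots> = (LINT t|lebesgue. indicator {..<x} t * (indicator {l<..<r} t * v t))"
      using x by (intro Bochner_Integration.integral_cong) (auto simp: indicator_def)
    also have "\<dots> = (LINT t|lebesgue. (if t < x then g t else 0))"
    proof (rule integral_cong_AE)
      show "(\<lambda>t. indicator {..<x} t * (indicator {l<..<r} t * v t)) \<in> borel_measurable lebesgue"
        by (rule lebesgue_measurable_indicator_times[OF borel_measurable_integrable[OF fi]]) simp
      show "AE t in lebesgue. indicator {..<x} t * (indicator {l<..<r} t * v t) = (if t < x then g t else 0)"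
        using ae by eventually_elim (auto simp: indicator_def)
    qed (intro measurable_completion, measurable)
    also have "\<dots> = (LINT t|lborel. (if t < x then g t else 0))"
      by (rule integral_completion) measurable
    finally show ?thesis by (simp add: integral_open_interval_real)
  qed
  have tail: "(LINT x|lborel. (if t < x then D x else 0)) = - \<phi> t" for t
  proof -
    have "(LINT x|lborel. (if t < x then D x else 0)) = (LINT x|lborel. D x * indicator {t..max t r} x)"
    proof (rule integral_cong_AE)
      show "AE x in lborel. (if t < x then D x else 0) = D x * indicator {t..max t r} x"
        using AE_lborel_singleton[of t]
        by eventually_elim (auto simp: indicator_def intro!: Dout)
    qed measurable
    also have "\<dots> = \<phi> (max t r) - \<phi> t"
      using Dcont deriv
      by (intro integral_FTC_Icc_real) (auto simp: continuous_on_eq_continuous_at)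
    also have "\<dots> = - \<phi> t" using pq by simp
    finally show ?thesis .
  qed
  have pi: "integrable (lborel \<Otimes>\<^sub>M lborel) (\<lambda>(x, t). if t < x then g t * D x else 0)"
  proof (rule lborel_pair.Fubini_integrable)
    have i: "integrable lborel (\<lambda>t. if t < x then g t * D x else 0)" for x
      by (rule Bochner_Integration.integrable_bound[OF integrable_mult_left[OF g, of "D x"]])
        (auto intro!: AE_I2)
    show "AE x in lborel. integrable lborel (\<lambda>t. case (x, t) of (x, t) \<Rightarrow> if t < x then g t * D x else 0)"
      using i by simp
    have "integrable lborel (\<lambda>x. LINT t|lborel. \<bar>if t < x then g t * D x else 0\<bar>)"
    proof (rule Bochner_Integration.integrable_bound)
      show "integrable lborel (\<lambda>x. (LINT t|lborel. \<bar>g t\<bar>) * D x)"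
        by (rule integrable_mult_right[OF Dint])
      show "AE x in lborel. norm (LINT t|lborel. \<bar>if t < x then g t * D x else 0\<bar>)
          \<le> norm ((LINT t|lborel. \<bar>g t\<bar>) * D x)"
      proof (rule AE_I2)
        fix x
        have "(LINT t|lborel. \<bar>if t < x then g t * D x else 0\<bar>) \<le> (LINT t|lborel. \<bar>g t\<bar> * \<bar>D x\<bar>)"
          using i[of x] g by (intro integral_mono) (auto simp: abs_mult)
        then show "norm (LINT t|lborel. \<bar>if t < x then g t * D x else 0\<bar>)
          \<le> norm ((LINT t|lborel. \<bar>g t\<bar>) * D x)"
          by (simp add: abs_mult)
      qed
    qed measurable
    then show "integrable lborel
        (\<lambda>x. LINT t|lborel. norm (case (x, t) of (x, t) \<Rightarrow> if t < x then g t * D x else 0))"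
      by simp
  qed measurable
  have "(LINT x|lebesgue_on {l<..<r}. integral {l..x} v * D x)
      = (LINT x|lebesgue. indicator {l<..<r} x * (integral {l..x} v * D x))"
    by (simp add: integral_lebesgue_on_eq)
  also have "\<dots> = (LINT x|lebesgue. (LINT t|lborel. (if t < x then g t else 0)) * D x)"
  proof (intro Bochner_Integration.integral_cong refl)
    fix x
    show "indicator {l<..<r} x * (integral {l..x} v * D x)
        = (LINT t|lborel. (if t < x then g t else 0)) * D x"
      by (cases "x \<in> {l<..<r}") (auto simp: prim Dout)
  qed
  also have "\<dots> = (LINT x|lborel. (LINT t|lborel. (if t < x then g t else 0)) * D x)"
    by (rule integral_completion) measurable
  also have "\<dots> = (LINT x|lborel. LINT t|lborel. (if t < x then g t * D x else 0))"
  proof (intro Bochner_Integration.integral_cong refl)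
    fix x
    have "(LINT t|lborel. (if t < x then g t else 0)) * D x
        = (LINT t|lborel. (if t < x then g t else 0) * D x)"
      by (rule integral_mult_left_zero[symmetric])
    also have "\<dots> = (LINT t|lborel. (if t < x then g t * D x else 0))"
      by (intro Bochner_Integration.integral_cong) auto
    finally show "(LINT t|lborel. (if t < x then g t else 0)) * D x
        = (LINT t|lborel. (if t < x then g t * D x else 0))" .
  qed
  also have "\<dots> = (LINT t|lborel. LINT x|lborel. (if t < x then g t * D x else 0))"
    using lborel_pair.Fubini_integral[OF pi] by simp
  also have "\<dots> = (LINT t|lborel. g t * (LINT x|lborel. (if t < x then D x else 0)))"
  proof (intro Bochner_Integration.integral_cong refl)
    fix t
    have "g t * (LINT x|lborel. (if t < x then D x else 0))
        = (LINT x|lborel. g t * (if t < x then D x else 0))"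
      by (rule integral_mult_right_zero[symmetric])
    also have "\<dots> = (LINT x|lborel. (if t < x then g t * D x else 0))"
      by (intro Bochner_Integration.integral_cong) auto
    finally show "(LINT x|lborel. (if t < x then g t * D x else 0))
        = g t * (LINT x|lborel. (if t < x then D x else 0))" by simp
  qed
  also have "\<dots> = - (LINT t|lborel. g t * \<phi> t)"
    by (simp add: tail)
  also have "(LINT t|lborel. g t * \<phi> t) = (LINT t|lebesgue. g t * \<phi> t)"
    by (rule integral_completion[symmetric]) measurable
  also have "\<dots> = (LINT t|lebesgue. (indicator {l<..<r} t * v t) * \<phi> t)"
  proof (rule integral_cong_AE)
    show "(\<lambda>t. (indicator {l<..<r} t * v t) * \<phi> t) \<in> borel_measurable lebesgue"
      by (rule borel_measurable_times[OF borel_measurable_integrable[OF fi]],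
          rule measurable_completion) simp
    show "AE t in lebesgue. g t * \<phi> t = (indicator {l<..<r} t * v t) * \<phi> t"
      using ae by eventually_elim simp
  qed (intro measurable_completion, measurable)
  also have "\<dots> = (LINT t|lebesgue_on {l<..<r}. v t * \<phi> t)"
    by (simp add: integral_lebesgue_on_eq mult.assoc)
  finally show ?thesis unfolding D_def .
qed

text \<open>The difference of \<open>u\<close> and the primitive of \<open>v\<close> has weak derivative zero, hence is constant.\<close>

lemma weak_deriv_primitive:
  fixes u v :: "real \<Rightarrow> real"
  assumes "l < r" and uv: "has_weak_deriv {l<..<r} 1 u v"
    and v: "integrable (lebesgue_on {l<..<r}) v"
  obtains g where "continuous_on {l..r} g" "AE x in lebesgue_on {l<..<r}. u x = g x"
    "\<And>x. g x = g l + integral {l..x} v" "v integrable_on {l..r}"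
proof -
  define V where "V x = integral {l..x} v" for x
  have vi: "v integrable_on {l..r}"
    using integrable_on_lebesgue_on[OF v] by (simp add: integrable_on_open_interval_real)
  have Vcont: "continuous_on {l..r} V"
    unfolding V_def by (rule indefinite_integral_continuous_1[OF vi])
  have V: "loc_integrable {l<..<r} V" by (rule loc_integrable_continuous[OF Vcont])
  have u: "loc_integrable {l<..<r} u" using uv by (simp add: has_weak_deriv_def)
  have "\<exists>C. AE x in lebesgue_on {l<..<r}. u x + (- 1) * V x = C"
  proof (rule du_Bois_Reymond[OF \<open>l < r\<close> loc_integrable_add_cmult[OF u V]])
    fix \<phi> assume \<phi>: "test_function {l<..<r} \<phi>"
    let ?D = "\<lambda>x. frechet_derivative \<phi> (at x) 1"
    note D = test_function_derivative[OF \<open>l < r\<close> \<phi>]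
    have "(LINT x|lebesgue_on {l<..<r}. (u x + (- 1) * V x) * ?D x)
        = (LINT x|lebesgue_on {l<..<r}. u x * ?D x - V x * ?D x)"
      by (simp add: algebra_simps)
    also have "\<dots> = (LINT x|lebesgue_on {l<..<r}. u x * ?D x) - (LINT x|lebesgue_on {l<..<r}. V x * ?D x)"
      by (intro Bochner_Integration.integral_diff test_function_times_loc_integrable[OF \<open>l < r\<close>] u V D)
    also have "\<dots> = 0"
      using uv \<phi> weak_integration_by_parts[OF \<open>l < r\<close> v \<phi>]
      unfolding has_weak_deriv_def V_def by simp
    finally show "(LINT x|lebesgue_on {l<..<r}. (u x + (- 1) * V x) * ?D x) = 0" .
  qed blast
  then obtain C where C: "AE x in lebesgue_on {l<..<r}. u x + (- 1) * V x = C" by blast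
  show thesis
  proof
    show "continuous_on {l..r} (\<lambda>x. C + V x)" by (intro continuous_intros Vcont)
    show "AE x in lebesgue_on {l<..<r}. u x = C + V x" using C by eventually_elim simp
    show "C + V x = C + V l + integral {l..x} v" for x unfolding V_def by simp
  qed (rule vi)
qed

text \<open>Because \<open>weak_deriv\<close> is a choice, properties of one particular weak derivative, such as square
  integrability, reach the chosen one only through uniqueness.\<close>

lemma has_weak_deriv_unique:
  fixes u v v' :: "real \<Rightarrow> real"
  assumes "l < r" and v: "has_weak_deriv {l<..<r} 1 u v" and v': "has_weak_deriv {l<..<r} 1 u v'"
  shows "AE x in lebesgue_on {l<..<r}. v x = v' x"
proof -
  have "loc_integrable {l<..<r} v" and "loc_integrable {l<..<r} v'"
    using v v' by (auto simp: has_weak_deriv_def)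
  note li = this and int = this[THEN test_function_times_loc_integrable[OF \<open>l < r\<close>]]
  have "AE x in lebesgue_on {l<..<r}. v x + (- 1) * v' x = 0"
  proof (rule AE_zero_if_weakly_zero[OF \<open>l < r\<close> loc_integrable_add_cmult[OF li]])
    fix \<phi> assume \<phi>: "test_function {l<..<r} \<phi>"
    have "(LINT x|lebesgue_on {l<..<r}. (v x + (- 1) * v' x) * \<phi> x)
        = (LINT x|lebesgue_on {l<..<r}. v x * \<phi> x - v' x * \<phi> x)"
      by (simp add: algebra_simps)
    also have "\<dots> = 0"
      using v v' \<phi> int[OF \<phi>] by (simp add: has_weak_deriv_def)
    finally show "(LINT x|lebesgue_on {l<..<r}. (v x + (- 1) * v' x) * \<phi> x) = 0" .
  qed
  then show ?thesis by eventually_elim simp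
qed

section \<open>Continuous representatives\<close>

lemma finite_measure_lebesgue_on_Ioo: "finite_measure (lebesgue_on {l<..<r::real})"
  by (rule finite_measure_lebesgue_on) simp

lemma integral_cong_AE_Ioo:
  fixes f g :: "real \<Rightarrow> real"
  assumes "AE x in lebesgue_on {l<..<r}. f x = g x" "y \<le> r"
  shows "integral {l..y} f = integral {l..y} g"
proof -
  have "AE x in lborel. x \<in> {l<..<r} \<longrightarrow> f x = g x"
    using assms(1) by (simp add: AE_lebesgue_on_iff AE_completion_iff)
  then have ae: "AE x in lborel. x \<in> {l<..<y} \<longrightarrow> f x = g x"
    by eventually_elim (use \<open>y \<le> r\<close> in auto)
  have "(f has_integral I) {l<..<y} \<longleftrightarrow> (g has_integral I) {l<..<y}" for I
    by (rule has_integral_AE[OF ae])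
  then have "integral {l<..<y} f = integral {l<..<y} g"
    unfolding integral_def integrable_on_def by simp
  then show ?thesis by (simp add: integral_open_interval_real)
qed

lemma L2_imp_integrable:
  assumes "f \<in> L2 {l<..<r::real}"
  shows "integrable (lebesgue_on {l<..<r}) f"
proof -
  interpret finite_measure "lebesgue_on {l<..<r}" by (rule finite_measure_lebesgue_on_Ioo)
  show ?thesis
  proof (rule Bochner_Integration.integrable_bound)
    show "integrable (lebesgue_on {l<..<r}) (\<lambda>x. 1 + (f x)\<^sup>2)"
      using assms by (simp add: L2_def)
    show "AE x in lebesgue_on {l<..<r}. norm (f x) \<le> norm (1 + (f x)\<^sup>2)"
    proof (rule AE_I2)
      fix x
      have "0 \<le> (\<bar>f x\<bar> - 1)\<^sup>2" by simp
      then show "norm (f x) \<le> norm (1 + (f x)\<^sup>2)"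
        by (simp add: power2_diff)
    qed
  qed (use assms in \<open>simp add: L2_def\<close>)
qed

text \<open>A set of full measure is dense, as nonempty open intervals have positive measure. This is
  how inequalities and equations that hold almost everywhere are extended to every point of the
  closed interval for continuous functions.\<close>

lemma closure_AE_Ioo:
  fixes l r :: real
  assumes "l < r" and ae: "AE x in lebesgue_on {l<..<r}. Q x"
  shows "closure {x \<in> {l<..<r}. Q x} = {l..r}"
proof
  have "{x \<in> {l<..<r}. Q x} \<subseteq> {l..r}" by auto
  then show "closure {x \<in> {l<..<r}. Q x} \<subseteq> {l..r}"
    by (rule closure_minimal) simp
  show "{l..r} \<subseteq> closure {x \<in> {l<..<r}. Q x}"
  proof
    fix x assume x: "x \<in> {l..r}"
    show "x \<in> closure {x \<in> {l<..<r}. Q x}"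
      unfolding closure_approachable
    proof (intro allI impI, rule ccontr)
      fix e :: real assume "e > 0" and no: "\<not> (\<exists>y\<in>{x \<in> {l<..<r}. Q x}. dist y x < e)"
      define a b where "a = max l (x - e)" and "b = min r (x + e)"
      have ab: "a < b" "l \<le> a" "b \<le> r" using x \<open>e > 0\<close> \<open>l < r\<close> by (auto simp: a_def b_def)
      have nq: "\<not> Q y" if "y \<in> {a<..<b}" for y
      proof
        assume "Q y"
        moreover have "y \<in> {l<..<r}" "dist y x < e"
          using that by (auto simp: a_def b_def dist_real_def)
        ultimately show False using no by blast
      qed
      have "AE y in lborel. y \<in> {l<..<r} \<longrightarrow> Q y"
        using ae by (simp add: AE_lebesgue_on_iff AE_completion_iff)
      then have "AE y in lborel. y \<notin> {a<..<b}"
        by eventually_elim (use ab nq in auto)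
      then have "{a<..<b} \<in> null_sets lborel"
        by (subst AE_iff_null_sets) auto
      then have "emeasure lborel {a<..<b} = 0" by auto
      then show False using ab by simp
    qed
  qed
qed

lemma continuous_AE_ge:
  fixes f :: "real \<Rightarrow> real"
  assumes "l < r" "continuous_on {l..r} f" "AE x in lebesgue_on {l<..<r}. a \<le> f x" "y \<in> {l..r}"
  shows "a \<le> f y"
proof -
  have cl: "closure {x \<in> {l<..<r}. a \<le> f x} = {l..r}"
    by (rule closure_AE_Ioo[OF assms(1,3)])
  show ?thesis
    by (rule continuous_ge_on_closure[of "{x \<in> {l<..<r}. a \<le> f x}"])
      (use assms(2,4) cl in simp_all)
qed

lemma continuous_AE_eq:
  fixes f g :: "real \<Rightarrow> real"
  assumes "l < r" "continuous_on {l..r} f" "continuous_on {l..r} g"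
    "AE x in lebesgue_on {l<..<r}. f x = g x" "y \<in> {l..r}"
  shows "f y = g y"
proof (rule antisym)
  have "AE x in lebesgue_on {l<..<r}. 0 \<le> g x - f x" "AE x in lebesgue_on {l<..<r}. 0 \<le> f x - g x"
    using assms(4) by (eventually_elim, simp)+
  then show "f y \<le> g y" "g y \<le> f y"
    using continuous_AE_ge[OF \<open>l < r\<close>, of "\<lambda>x. g x - f x" 0 y]
      continuous_AE_ge[OF \<open>l < r\<close>, of "\<lambda>x. f x - g x" 0 y] assms
    by (auto intro: continuous_on_diff)
qed

lemma cont_rep_eq:
  assumes "H > 0" "continuous_on {0..H} g" "AE y in lebesgue_on {0<..<H}. f y = g y" "y \<in> {0..H}"
  shows "cont_rep H f y = g y"
proof -
  have "continuous_on {0..H} (cont_rep H f) \<and> (AE y in lebesgue_on {0<..<H}. f y = cont_rep H f y)"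
    unfolding cont_rep_def by (rule someI[of _ g]) (use assms in simp)
  then have c: "continuous_on {0..H} (cont_rep H f)"
    and ae: "AE y in lebesgue_on {0<..<H}. f y = cont_rep H f y" by auto
  have "AE y in lebesgue_on {0<..<H}. cont_rep H f y = g y"
    using ae assms(3) by eventually_elim simp
  then show ?thesis using continuous_AE_eq[OF assms(1) c assms(2) _ assms(4)] by blast
qed

text \<open>The last conclusion is the regularity gain used below: once the weak derivative is known to agree
  almost everywhere with a continuous function, the representative is classically
  differentiable, including one-sidedly at the end points.\<close>

lemma H1_continuous_primitive:
  assumes "H > 0" and u: "u \<in> H1 {0<..<H}"
  obtains g where "continuous_on {0..H} g" "AE x in lebesgue_on {0<..<H}. u x = g x"
    "\<And>k y. continuous_on {0..H} k \<Longrightarrow> AE x in lebesgue_on {0<..<H}. wd H u x = k x \<Longrightarrow>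
       y \<in> {0..H} \<Longrightarrow> (g has_real_derivative k y) (at y within {0..H})"
proof -
  obtain v where vL2: "v \<in> L2 {0<..<H}" and v: "has_weak_deriv {0<..<H} 1 u v"
    using u by (auto simp: H1_def)
  have "has_weak_deriv {0<..<H} 1 u (wd H u)"
    unfolding weak_deriv_def by (rule someI[of "has_weak_deriv {0<..<H} 1 u" v, OF v])
  from has_weak_deriv_unique[OF \<open>H > 0\<close> this v]
  have wv: "AE x in lebesgue_on {0<..<H}. wd H u x = v x" .
  obtain g where g: "continuous_on {0..H} g" "AE x in lebesgue_on {0<..<H}. u x = g x"
    and prim: "\<And>x. g x = g 0 + integral {0..x} v"
    using weak_deriv_primitive[OF \<open>H > 0\<close> v L2_imp_integrable[OF vL2]] by blast
  show thesis
  proof (rule that[OF g])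
    fix k y assume k: "continuous_on {0..H} k" and ae: "AE x in lebesgue_on {0<..<H}. wd H u x = k x"
      and y: "y \<in> {0..H}"
    have "AE x in lebesgue_on {0<..<H}. v x = k x"
      using wv ae by eventually_elim simp
    then have gk: "g x = g 0 + integral {0..x} k" if "x \<in> {0..H}" for x
      using prim[of x] integral_cong_AE_Ioo that by force
    have "((\<lambda>x. g 0 + integral {0..x} k) has_real_derivative k y) (at y within {0..H})"
      using integral_has_real_derivative[OF k y] by (auto intro!: derivative_eq_intros)
    then show "(g has_real_derivative k y) (at y within {0..H})"
      by (rule has_field_derivative_transform_within[OF _ zero_less_one y]) (rule gk[symmetric])
  qed
qed

lemma L_infty_bound:
  assumes "f \<in> L_infty S"
  obtains B where "B \<ge> 0" "AE x in lebesgue_on S. \<bar>f x\<bar> \<le> B"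
proof -
  let ?e = "esssup (lebesgue_on S) (\<lambda>x. ereal \<bar>f x\<bar>)"
  have "?e \<noteq> \<infinity>" using assms by (simp add: L_infty_def)
  then obtain B where B: "?e \<le> ereal B" by (cases ?e) auto
  have "AE x in lebesgue_on S. \<bar>f x\<bar> \<le> max 0 B"
    using esssup_AE[where M = "lebesgue_on S" and f = "\<lambda>x. ereal \<bar>f x\<bar>"]
  proof eventually_elim
    case (elim x)
    then have "ereal \<bar>f x\<bar> \<le> ereal B" using B order_trans by blast
    then show ?case by simp
  qed
  then show thesis by (rule that[rotated]) simp
qed

text \<open>The Lipschitz constant is an essential bound of the weak derivative, since the increments of the
  representative are integrals of that derivative.\<close>

lemma W1_infty_Lipschitz_representative:
  assumes "l < r" and c: "c \<in> W1_infty {l<..<r::real}"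
  obtains L C where "L \<ge> 0" "continuous_on {l..r} C" "AE x in lebesgue_on {l<..<r}. c x = C x"
    "\<forall>x\<in>{l..r}. \<forall>y\<in>{l..r}. \<bar>C x - C y\<bar> \<le> L * \<bar>x - y\<bar>"
proof -
  interpret finite_measure "lebesgue_on {l<..<r}" by (rule finite_measure_lebesgue_on_Ioo)
  obtain v where vL: "v \<in> L_infty {l<..<r}" and v: "has_weak_deriv {l<..<r} 1 c v"
    using c by (auto simp: W1_infty_def)
  obtain L where "L \<ge> 0" and L: "AE x in lebesgue_on {l<..<r}. \<bar>v x\<bar> \<le> L"
    using L_infty_bound[OF vL] .
  have vint: "integrable (lebesgue_on {l<..<r}) v"
    using L vL by (intro integrable_const_bound[of _ L]) (auto simp: L_infty_def)
  obtain C where C: "continuous_on {l..r} C" "AE x in lebesgue_on {l<..<r}. c x = C x"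
    and prim: "\<And>x. C x = C l + integral {l..x} v" and vi: "v integrable_on {l..r}"
    using weak_deriv_primitive[OF \<open>l < r\<close> v vint] by blast
  \<comment> \<open>Changing \<open>v\<close> on a null set makes the bound hold everywhere, and the integrals stay the same.\<close>
  define w where "w x = (if \<bar>v x\<bar> \<le> L then v x else 0)" for x
  have ae: "AE x in lebesgue_on {l<..<r}. v x = w x"
    using L by eventually_elim (simp add: w_def)
  have "AE x in lborel. x \<in> {l<..<r} \<longrightarrow> v x = w x"
    using ae by (simp add: AE_lebesgue_on_iff AE_completion_iff)
  from has_integral_AE[OF this] have "w integrable_on {l<..<r} \<longleftrightarrow> v integrable_on {l<..<r}"
    unfolding integrable_on_def by simp
  with vi have wi: "w integrable_on {l..r}" by (simp add: integrable_on_open_interval_real)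
  have *: "\<bar>C y - C x\<bar> \<le> L * (y - x)" if xy: "l \<le> x" "x \<le> y" "y \<le> r" for x y
  proof -
    have "C y - C x = integral {l..y} w - integral {l..x} w"
      using prim[of x] prim[of y] integral_cong_AE_Ioo[OF ae, of x] integral_cong_AE_Ioo[OF ae, of y] xy
      by simp
    also have "\<dots> = integral {x..y} w"
      using xy Henstock_Kurzweil_Integration.integral_combine[of l x y w]
        integrable_on_subinterval[OF wi, of l y] by simp
    finally have eq: "C y - C x = integral {x..y} w" .
    have "w integrable_on {x..y}"
      using xy by (intro integrable_on_subinterval[OF wi]) auto
    then have "(w has_integral integral {x..y} w) {x..y}" by (rule integrable_integral)
    from has_integral_bound_real[OF \<open>L \<ge> 0\<close> finite.emptyI this]
    have "norm (integral {x..y} w) \<le> L * (y - x)"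
      using xy \<open>L \<ge> 0\<close> by (simp add: w_def)
    then show ?thesis using eq by simp
  qed
  show thesis
  proof (rule that[OF \<open>L \<ge> 0\<close> C], intro ballI)
    fix x y assume "x \<in> {l..r}" "y \<in> {l..r}"
    then show "\<bar>C x - C y\<bar> \<le> L * \<bar>x - y\<bar>"
      using *[of x y] *[of y x] by (cases "x \<le> y") (auto simp: abs_minus_commute)
  qed
qed

lemma coefficients_AE_bounds:
  assumes "c \<in> coefficients H c\<^sub>m c\<^sub>M"
  shows "AE y in lebesgue_on {0<..<H}. c\<^sub>m \<le> c y \<and> c y \<le> c\<^sub>M"
proof -
  let ?M = "lebesgue_on {0..H}"
  have lower: "esssup ?M (\<lambda>y. - ereal (c y)) = - ereal c\<^sub>m"
    and upper: "esssup ?M (\<lambda>y. ereal (c y)) = ereal c\<^sub>M"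
  proof -
    have "- esssup ?M (\<lambda>y. - ereal (c y)) = ereal c\<^sub>m"
      using assms unfolding coefficients_def essinf_def by blast
    then show "esssup ?M (\<lambda>y. - ereal (c y)) = - ereal c\<^sub>m"
      by (metis ereal_uminus_uminus)
    show "esssup ?M (\<lambda>y. ereal (c y)) = ereal c\<^sub>M"
      using assms unfolding coefficients_def by blast
  qed
  have "AE y in ?M. c\<^sub>m \<le> c y \<and> c y \<le> c\<^sub>M"
    using esssup_AE[where M = ?M and f = "\<lambda>y. - ereal (c y)"]
      esssup_AE[where M = ?M and f = "\<lambda>y. ereal (c y)"]
    unfolding lower upper by eventually_elim simp
  then have "AE y in lebesgue. y \<in> {0..H} \<longrightarrow> c\<^sub>m \<le> c y \<and> c y \<le> c\<^sub>M"
    by (subst (asm) AE_lebesgue_on_iff) auto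
  then have "AE y in lebesgue. y \<in> {0<..<H} \<longrightarrow> c\<^sub>m \<le> c y \<and> c y \<le> c\<^sub>M"
    by eventually_elim simp
  then show ?thesis
    by (subst AE_lebesgue_on_iff) auto
qed

text \<open>The mean value of \<open>u\<^sup>2\<close> over the interval is \<open>1 / H\<close>, so the maximum of the continuous
  representative squared is at least that.\<close>

lemma normalized_sq_attains:
  assumes "H > 0" and U: "continuous_on {0..H} U" and ae: "AE y in lebesgue_on {0<..<H}. u y = U y"
    and um: "u \<in> L2 {0<..<H}" and norm: "(LINT y|lebesgue_on {0<..<H}. (u y)\<^sup>2) = 1"
  shows "\<exists>z\<in>{0..H}. 1 / H \<le> (U z)\<^sup>2"
proof -
  let ?M = "lebesgue_on {0<..<H}"
  interpret finite_measure ?M by (rule finite_measure_lebesgue_on_Ioo)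
  have "continuous_on {0..H} (\<lambda>y. (U y)\<^sup>2)" by (intro continuous_intros U)
  then obtain z where z: "z \<in> {0..H}" "\<And>y. y \<in> {0..H} \<Longrightarrow> (U y)\<^sup>2 \<le> (U z)\<^sup>2"
    using continuous_attains_sup[of "{0..H}" "\<lambda>y. (U y)\<^sup>2"] \<open>H > 0\<close> by auto
  have "AE y in ?M. y \<in> {0<..<H}" by (intro AE_I2) simp
  with ae have le: "AE y in ?M. (u y)\<^sup>2 \<le> (U z)\<^sup>2"
    by eventually_elim (use z(2) in auto)
  have "(LINT y|?M. (u y)\<^sup>2) \<le> (LINT y|?M. (U z)\<^sup>2)"
    using um le by (intro integral_mono_AE) (auto simp: L2_def)
  also have "\<dots> = (U z)\<^sup>2 * H"
    using \<open>H > 0\<close> by (simp add: measure_restrict_space)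
  finally have "1 \<le> (U z)\<^sup>2 * H" using norm by simp
  then show ?thesis using z(1) \<open>H > 0\<close> by (intro bexI[of _ z]) (simp_all add: field_simps)
qed


section \<open>The energy of a solution\<close>

text \<open>A Gronwall estimate for functions that need not be differentiable. The exponential
  bound is multiplicative under concatenation of intervals, so by bisection it suffices to
  prove it for short intervals around each point, where it follows from \<open>1 + x \<le> exp x\<close>.
  Both \<open>E s\<close> and \<open>E t\<close> are allowed for in the local bound because the exponential estimate is needed in both
  directions.\<close>

lemma exp_comparison_if_local:
  fixes E :: "real \<Rightarrow> real"
  assumes "a \<le> b" and pos: "\<And>t. t \<in> {a..b} \<Longrightarrow> E t > 0"
    and local: "\<And>s. s \<in> {a..b} \<Longrightarrow>
      \<exists>d>0. \<forall>t\<in>{a..b}. \<bar>t - s\<bar> < d \<longrightarrow>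
        \<bar>E t - E s\<bar> \<le> K * E s * \<bar>t - s\<bar> \<and> \<bar>E t - E s\<bar> \<le> K * E t * \<bar>t - s\<bar>"
  shows "E b \<le> exp (K * (b - a)) * E a" "E a \<le> exp (K * (b - a)) * E b"
proof -
  have "a \<le> a \<and> b \<le> b \<longrightarrow>
      E b \<le> exp (K * (b - a)) * E a \<and> E a \<le> exp (K * (b - a)) * E b"
  proof (rule Bolzano[where P = "\<lambda>s t. a \<le> s \<and> t \<le> b \<longrightarrow>
      E t \<le> exp (K * (t - s)) * E s \<and> E s \<le> exp (K * (t - s)) * E t", OF \<open>a \<le> b\<close>])
    fix x y z
    assume xy: "a \<le> x \<and> y \<le> b \<longrightarrow> E y \<le> exp (K * (y - x)) * E x \<and> E x \<le> exp (K * (y - x)) * E y"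
      and yz: "a \<le> y \<and> z \<le> b \<longrightarrow> E z \<le> exp (K * (z - y)) * E y \<and> E y \<le> exp (K * (z - y)) * E z"
      and le: "x \<le> y" "y \<le> z"
    have e: "exp (K * (z - x)) = exp (K * (y - x)) * exp (K * (z - y))"
      by (simp add: exp_add[symmetric] algebra_simps)
    show "a \<le> x \<and> z \<le> b \<longrightarrow> E z \<le> exp (K * (z - x)) * E x \<and> E x \<le> exp (K * (z - x)) * E z"
    proof
      assume *: "a \<le> x \<and> z \<le> b"
      have 1: "E z \<le> exp (K * (z - y)) * E y" "E y \<le> exp (K * (z - y)) * E z"
        and 2: "E y \<le> exp (K * (y - x)) * E x" "E x \<le> exp (K * (y - x)) * E y"
        using xy yz le * by auto
      have "E z \<le> exp (K * (z - y)) * (exp (K * (y - x)) * E x)"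
        by (rule order_trans[OF 1(1) mult_left_mono[OF 2(1)]]) simp
      moreover have "E x \<le> exp (K * (y - x)) * (exp (K * (z - y)) * E z)"
        by (rule order_trans[OF 2(2) mult_left_mono[OF 1(2)]]) simp
      ultimately show "E z \<le> exp (K * (z - x)) * E x \<and> E x \<le> exp (K * (z - x)) * E z"
        unfolding e by (simp add: mult_ac)
    qed
  next
    fix s assume s: "a \<le> s" "s \<le> b"
    then obtain d where "d > 0" and d: "\<And>t. t \<in> {a..b} \<Longrightarrow> \<bar>t - s\<bar> < d \<Longrightarrow>
        \<bar>E t - E s\<bar> \<le> K * E s * \<bar>t - s\<bar> \<and> \<bar>E t - E s\<bar> \<le> K * E t * \<bar>t - s\<bar>"
      using local[of s] by auto
    have step: "E t \<le> exp (K * \<bar>t - s\<bar>) * E s \<and> E s \<le> exp (K * \<bar>t - s\<bar>) * E t"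
      if t: "t \<in> {a..b}" "\<bar>t - s\<bar> < d" for t
    proof -
      have "E t \<le> (1 + K * \<bar>t - s\<bar>) * E s" "E s \<le> (1 + K * \<bar>t - s\<bar>) * E t"
        using d[OF t] by (auto simp: algebra_simps abs_if split: if_splits)
      moreover have "(1 + K * \<bar>t - s\<bar>) * E x \<le> exp (K * \<bar>t - s\<bar>) * E x" if "x \<in> {a..b}" for x
        using pos[OF that] by (intro mult_right_mono) auto
      ultimately show ?thesis using s t by (meson atLeastAtMost_iff order_trans)
    qed
    show "\<exists>d>0. \<forall>x y. x \<le> s \<and> s \<le> y \<and> y - x < d \<longrightarrow>
        (a \<le> x \<and> y \<le> b \<longrightarrow> E y \<le> exp (K * (y - x)) * E x \<and> E x \<le> exp (K * (y - x)) * E y)"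
    proof (intro exI[of _ d] conjI allI impI \<open>d > 0\<close>)
      fix x y
      assume *: "x \<le> s \<and> s \<le> y \<and> y - x < d" "a \<le> x \<and> y \<le> b"
      have 1: "E y \<le> exp (K * (y - s)) * E s" "E s \<le> exp (K * (y - s)) * E y"
        using step[of y] * by auto
      have 2: "E x \<le> exp (K * (s - x)) * E s" "E s \<le> exp (K * (s - x)) * E x"
        using step[of x] * by auto
      have e: "exp (K * (y - x)) = exp (K * (s - x)) * exp (K * (y - s))"
        by (simp add: exp_add[symmetric] algebra_simps)
      have "E y \<le> exp (K * (y - s)) * (exp (K * (s - x)) * E x)"
        by (rule order_trans[OF 1(1) mult_left_mono[OF 2(2)]]) simp
      then show "E y \<le> exp (K * (y - x)) * E x" unfolding e by (simp add: mult_ac)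
      have "E x \<le> exp (K * (s - x)) * (exp (K * (y - s)) * E y)"
        by (rule order_trans[OF 2(1) mult_left_mono[OF 1(2)]]) simp
      then show "E x \<le> exp (K * (y - x)) * E y" unfolding e by (simp add: mult_ac)
    qed
  qed
  then show "E b \<le> exp (K * (b - a)) * E a" "E a \<le> exp (K * (b - a)) * E b" by auto
qed

lemma zero_derivative_local_bound:
  fixes F :: "real \<Rightarrow> real"
  assumes "(F has_real_derivative 0) (at s within A)" "\<eta> > 0"
  shows "\<exists>d>0. \<forall>t\<in>A. \<bar>t - s\<bar> < d \<longrightarrow> \<bar>F t - F s\<bar> \<le> \<eta> * \<bar>t - s\<bar>"
proof -
  have "(F has_derivative (*) 0) (at s within A)"
    using assms(1) by (simp add: has_field_derivative_def)
  then show ?thesis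
    using \<open>\<eta> > 0\<close> unfolding has_derivative_within_alt by fastforce
qed

text \<open>Here \<open>\<kappa>\<close> stands for \<open>\<mu>\<^sup>2\<close>, and \<open>P\<close> for \<open>C U'\<close>. The assumption \<open>gap\<close> is the condition
  \<open>\<lambda> \<ge> (c\<^sub>M + \<epsilon>) \<mu>\<^sup>2\<close> for \<open>\<delta> = \<epsilon> / (c\<^sub>M + \<epsilon>)\<close>.\<close>

locale sturm_liouville_solution =
  fixes H L c\<^sub>m c\<^sub>M \<delta> \<kappa> lam :: real and C U P :: "real \<Rightarrow> real"
  assumes H: "H > 0" and cm: "c\<^sub>m > 0" and \<delta>: "\<delta> > 0" and lam: "lam > 0" and \<kappa>: "\<kappa> \<ge> 0"
    and L: "L \<ge> 0"
    and gap: "c\<^sub>M * \<kappa> \<le> (1 - \<delta>) * lam"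
    and C_bounds: "\<And>y. y \<in> {0..H} \<Longrightarrow> c\<^sub>m \<le> C y \<and> C y \<le> c\<^sub>M"
    and C_lip: "\<And>x y. x \<in> {0..H} \<Longrightarrow> y \<in> {0..H} \<Longrightarrow> \<bar>C x - C y\<bar> \<le> L * \<bar>x - y\<bar>"
    and U_deriv: "\<And>y. y \<in> {0..H} \<Longrightarrow> (U has_real_derivative P y / C y) (at y within {0..H})"
    and P_deriv: "\<And>y. y \<in> {0..H} \<Longrightarrow>
      (P has_real_derivative (C y * \<kappa> - lam) * U y) (at y within {0..H})"
begin

definition weight :: "real \<Rightarrow> real" where
  "weight y = C y * (lam - C y * \<kappa>)"

definition energy :: "real \<Rightarrow> real" where
  "energy y = (P y)\<^sup>2 + weight y * (U y)\<^sup>2"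

lemma C\<kappa>_bounds:
  assumes "y \<in> {0..H}"
  shows "0 \<le> C y * \<kappa>" "C y * \<kappa> \<le> (1 - \<delta>) * lam"
proof -
  show "0 \<le> C y * \<kappa>" using C_bounds[OF assms] cm \<kappa> by simp
  have "C y * \<kappa> \<le> c\<^sub>M * \<kappa>" using C_bounds[OF assms] \<kappa> by (simp add: mult_right_mono)
  then show "C y * \<kappa> \<le> (1 - \<delta>) * lam" using gap by linarith
qed

lemma weight_bounds:
  assumes "y \<in> {0..H}"
  shows "c\<^sub>m * \<delta> * lam \<le> weight y" "weight y \<le> c\<^sub>M * lam"
proof -
  have *: "\<delta> * lam \<le> lam - C y * \<kappa>" "lam - C y * \<kappa> \<le> lam"
    using C\<kappa>_bounds[OF assms] by (auto simp: algebra_simps)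
  have "c\<^sub>m * (\<delta> * lam) \<le> C y * (lam - C y * \<kappa>)"
    using * C_bounds[OF assms] cm \<delta> lam by (intro mult_mono) auto
  then show "c\<^sub>m * \<delta> * lam \<le> weight y" by (simp add: weight_def)
  have "0 \<le> lam - C y * \<kappa>"
    using *(1) \<delta> lam by (smt (verit) mult_pos_pos)
  then show "weight y \<le> c\<^sub>M * lam"
    unfolding weight_def using * C_bounds[OF assms] cm by (intro mult_mono) auto
qed

text \<open>The difference of the weights factors into \<open>C x - C y\<close> and \<open>\<lambda> - (C x + C y) \<kappa>\<close>. The second factor is
  bounded by \<open>\<lambda>\<close> in absolute value since \<open>C x \<kappa>\<close> and \<open>C y \<kappa>\<close> both lie between \<open>0\<close> and \<open>\<lambda>\<close>.\<close>

lemma weight_Lipschitz: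
  assumes x: "x \<in> {0..H}" and y: "y \<in> {0..H}"
  shows "\<bar>weight x - weight y\<bar> \<le> L * lam * \<bar>x - y\<bar>"
proof -
  have "weight x - weight y = (C x - C y) * (lam - C x * \<kappa> - C y * \<kappa>)"
    by (simp add: weight_def algebra_simps)
  then have "\<bar>weight x - weight y\<bar> = \<bar>C x - C y\<bar> * \<bar>lam - C x * \<kappa> - C y * \<kappa>\<bar>"
    by (simp add: abs_mult)
  also have "\<dots> \<le> (L * \<bar>x - y\<bar>) * lam"
  proof (intro mult_mono C_lip x y)
    have "\<delta> * lam > 0" using \<delta> lam by simp
    then show "\<bar>lam - C x * \<kappa> - C y * \<kappa>\<bar> \<le> lam"
      using C\<kappa>_bounds[OF x] C\<kappa>_bounds[OF y] by (simp add: abs_le_iff algebra_simps)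
  qed (use L in auto)
  finally show ?thesis by (simp add: mult_ac)
qed

lemma U_sq_le_energy:
  assumes "y \<in> {0..H}"
  shows "c\<^sub>m * \<delta> * lam * (U y)\<^sup>2 \<le> energy y"
proof -
  have "c\<^sub>m * \<delta> * lam * (U y)\<^sup>2 \<le> weight y * (U y)\<^sup>2"
    using weight_bounds[OF assms] by (intro mult_right_mono) auto
  then show ?thesis unfolding energy_def by (smt (verit) zero_le_power2)
qed

lemma energy_nonneg: "y \<in> {0..H} \<Longrightarrow> 0 \<le> energy y"
  using U_sq_le_energy[of y] cm \<delta> lam by (smt (verit) mult_nonneg_nonneg zero_le_power2)

text \<open>The summand \<open>1\<close> leaves room for the lower order terms in \<open>energy_local_growth\<close>. What matters is
  that neither \<open>\<kappa>\<close> nor \<open>lam\<close> occurs.\<close>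

definition rate :: real where
  "rate = L / (c\<^sub>m * \<delta>) + 1"

text \<open>With the weight frozen at \<open>s\<close>, the energy becomes a function \<open>F\<close> whose derivative vanishes at \<open>s\<close>. So
  the increment of the true energy is \<open>o(|t - s|)\<close> plus the variation of the weight times
  \<open>(U t)\<^sup>2\<close>, and \<open>U\<^sup>2\<close> is controlled by the energy. The positive shift \<open>\<tau>\<close> absorbs the error terms
  where the energy might vanish.\<close>

lemma energy_local_growth:
  assumes s: "s \<in> {0..H}" and "\<tau> > 0"
  shows "\<exists>d>0. \<forall>t\<in>{0..H}. \<bar>t - s\<bar> < d \<longrightarrow>
      \<bar>(energy t + \<tau>) - (energy s + \<tau>)\<bar> \<le> rate * (energy s + \<tau>) * \<bar>t - s\<bar> \<and>
      \<bar>(energy t + \<tau>) - (energy s + \<tau>)\<bar> \<le> rate * (energy t + \<tau>) * \<bar>t - s\<bar>"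
proof -
  define F where "F t = (P t)\<^sup>2 + weight s * (U t)\<^sup>2" for t
  have C0: "C s \<noteq> 0" using C_bounds[OF s] cm by auto
  have "(F has_real_derivative
      2 * P s * ((C s * \<kappa> - lam) * U s) + weight s * (2 * U s * (P s / C s))) (at s within {0..H})"
    unfolding F_def
    by (auto intro!: derivative_eq_intros U_deriv[OF s] P_deriv[OF s])
  also have "2 * P s * ((C s * \<kappa> - lam) * U s) + weight s * (2 * U s * (P s / C s)) = 0"
    using C0 by (simp add: weight_def field_simps)
  finally obtain d1 where "d1 > 0"
    and d1: "\<And>t. t \<in> {0..H} \<Longrightarrow> \<bar>t - s\<bar> < d1 \<Longrightarrow> \<bar>F t - F s\<bar> \<le> \<tau> / 2 * \<bar>t - s\<bar>"
    using zero_derivative_local_bound[of F s "{0..H}" "\<tau> / 2"] \<open>\<tau> > 0\<close> by auto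
  have "continuous (at s within {0..H}) (\<lambda>t. L * lam * (U t)\<^sup>2)"
    using DERIV_continuous[OF U_deriv[OF s]] by (intro continuous_intros)
  then obtain d2 where "d2 > 0"
    and d2: "\<And>t. t \<in> {0..H} \<Longrightarrow> \<bar>t - s\<bar> < d2 \<Longrightarrow> \<bar>L * lam * (U t)\<^sup>2 - L * lam * (U s)\<^sup>2\<bar> < \<tau> / 2"
    unfolding continuous_within_eps_delta dist_real_def using \<open>\<tau> > 0\<close> half_gt_zero by metis
  have absorb: "L * lam * (U y)\<^sup>2 \<le> L / (c\<^sub>m * \<delta>) * energy y" if "y \<in> {0..H}" for y
  proof -
    have "L / (c\<^sub>m * \<delta>) * (c\<^sub>m * \<delta> * lam * (U y)\<^sup>2) \<le> L / (c\<^sub>m * \<delta>) * energy y"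
      using U_sq_le_energy[OF that] L cm \<delta> by (intro mult_left_mono) auto
    then show ?thesis using cm \<delta> by simp
  qed
  have rate: "L / (c\<^sub>m * \<delta>) * energy y + \<tau> \<le> rate * (energy y + \<tau>)" if "y \<in> {0..H}" for y
    using energy_nonneg[OF that] L cm \<delta> \<open>\<tau> > 0\<close> unfolding rate_def
    by (simp add: algebra_simps add_nonneg_nonneg)
  show ?thesis
  proof (intro exI[of _ "min d1 d2"] conjI ballI impI)
    show "min d1 d2 > 0" using \<open>d1 > 0\<close> \<open>d2 > 0\<close> by simp
    fix t assume t: "t \<in> {0..H}" and "\<bar>t - s\<bar> < min d1 d2"
    then have lt: "\<bar>t - s\<bar> < d1" "\<bar>t - s\<bar> < d2" by auto
    have "\<bar>energy t - energy s\<bar> = \<bar>(F t - F s) + (weight t - weight s) * (U t)\<^sup>2\<bar>"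
      by (simp add: energy_def F_def algebra_simps)
    also have "\<dots> \<le> \<bar>F t - F s\<bar> + \<bar>weight t - weight s\<bar> * (U t)\<^sup>2"
      by (metis abs_mult abs_power2 abs_triangle_ineq)
    also have "\<dots> \<le> \<tau> / 2 * \<bar>t - s\<bar> + (L * lam * \<bar>t - s\<bar>) * (U t)\<^sup>2"
      by (intro add_mono d1[OF t lt(1)] mult_right_mono weight_Lipschitz[OF t s]) simp
    finally have est: "\<bar>energy t - energy s\<bar> \<le> (\<tau> / 2 + L * lam * (U t)\<^sup>2) * \<bar>t - s\<bar>"
      by (simp add: algebra_simps)
    have "\<tau> / 2 + L * lam * (U t)\<^sup>2 \<le> rate * (energy t + \<tau>)"
      using absorb[OF t] rate[OF t] \<open>\<tau> > 0\<close> by linarith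
    from order_trans[OF est mult_right_mono[OF this]]
    show "\<bar>(energy t + \<tau>) - (energy s + \<tau>)\<bar> \<le> rate * (energy t + \<tau>) * \<bar>t - s\<bar>" by simp
    have "\<tau> / 2 + L * lam * (U t)\<^sup>2 \<le> rate * (energy s + \<tau>)"
      using absorb[OF s] rate[OF s] d2[OF t lt(2)] by linarith
    from order_trans[OF est mult_right_mono[OF this]]
    show "\<bar>(energy t + \<tau>) - (energy s + \<tau>)\<bar> \<le> rate * (energy s + \<tau>) * \<bar>t - s\<bar>" by simp
  qed
qed

text \<open>The growth estimate holds for the energy shifted by any \<open>\<tau> > 0\<close>; let \<open>\<tau>\<close> tend to zero.\<close>

lemma energy_comparison:
  assumes y: "y \<in> {0..H}" and z: "z \<in> {0..H}"
  shows "energy z \<le> exp (rate * H) * energy y"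
proof -
  have rate0: "rate \<ge> 0" unfolding rate_def using L cm \<delta> by simp
  have "energy z + \<tau> \<le> exp (rate * H) * (energy y + \<tau>)" if "\<tau> > 0" for \<tau>
  proof -
    define a b where "a = min y z" and "b = max y z"
    have ab: "a \<le> b" "{a..b} \<subseteq> {0..H}" using y z by (auto simp: a_def b_def)
    have pos: "energy t + \<tau> > 0" if "t \<in> {a..b}" for t
      using energy_nonneg[of t] ab(2) that \<open>\<tau> > 0\<close> by force
    have local: "\<exists>d>0. \<forall>t\<in>{a..b}. \<bar>t - s\<bar> < d \<longrightarrow>
      \<bar>(energy t + \<tau>) - (energy s + \<tau>)\<bar> \<le> rate * (energy s + \<tau>) * \<bar>t - s\<bar> \<and>
      \<bar>(energy t + \<tau>) - (energy s + \<tau>)\<bar> \<le> rate * (energy t + \<tau>) * \<bar>t - s\<bar>"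
      if "s \<in> {a..b}" for s
      using energy_local_growth[of s \<tau>] ab(2) that \<open>\<tau> > 0\<close> by (meson subsetD)
    have "energy z + \<tau> \<le> exp (rate * (b - a)) * (energy y + \<tau>)"
      using exp_comparison_if_local[of a b "\<lambda>t. energy t + \<tau>" rate, OF ab(1) pos local]
      by (cases "y \<le> z") (auto simp: a_def b_def min_def max_def)
    also have "\<dots> \<le> exp (rate * H) * (energy y + \<tau>)"
      using energy_nonneg[OF y] \<open>\<tau> > 0\<close> rate0 y z
      by (intro mult_right_mono) (auto simp: a_def b_def intro!: mult_left_mono)
    finally show ?thesis .
  qed
  note tau = this
  have "((\<lambda>\<tau>. exp (rate * H) * (energy y + \<tau>) - (energy z + \<tau>)) \<longlongrightarrow>
      exp (rate * H) * (energy y + 0) - (energy z + 0)) (at_right 0)"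
    by (intro tendsto_intros)
  moreover have "\<forall>\<^sub>F \<tau> in at_right 0. 0 \<le> exp (rate * H) * (energy y + \<tau>) - (energy z + \<tau>)"
    using eventually_at_right_less by eventually_elim (use tau in force)
  ultimately have "0 \<le> exp (rate * H) * (energy y + 0) - (energy z + 0)"
    by (rule tendsto_lowerbound) simp
  then show ?thesis by simp
qed

text \<open>At \<open>z\<close> the energy is at least a multiple of \<open>lam\<close>, and at \<open>y\<close> it exceeds the amplitude by at most the factor
  \<open>1 + c\<^sub>M lam\<close>. The quotient \<open>lam / (1 + c\<^sub>M lam)\<close> increases with \<open>lam\<close>, so the lower end \<open>lam0\<close>
  of the admissible range gives a bound that is uniform in \<open>lam\<close>.\<close>

lemma amplitude_lower_bound:
  assumes y: "y \<in> {0..H}" and z: "z \<in> {0..H}" and lam0: "0 < lam0" "lam0 \<le> lam"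
  shows "exp (- rate * H) * (c\<^sub>m * \<delta> * (lam0 / (1 + c\<^sub>M * lam0))) * (U z)\<^sup>2 \<le> (U y)\<^sup>2 + (P y)\<^sup>2"
proof -
  have cM: "c\<^sub>M > 0" using C_bounds[OF y] cm by linarith
  have den: "1 + c\<^sub>M * lam > 0" "1 + c\<^sub>M * lam0 > 0" using cM lam lam0 by (auto intro: add_pos_pos)
  have "energy y \<le> (P y)\<^sup>2 + c\<^sub>M * lam * (U y)\<^sup>2"
    unfolding energy_def using weight_bounds[OF y] by (intro add_left_mono mult_right_mono) auto
  also have "\<dots> \<le> (1 + c\<^sub>M * lam) * ((U y)\<^sup>2 + (P y)\<^sup>2)"
    using cM lam by (simp add: algebra_simps)
  finally have up: "energy y \<le> (1 + c\<^sub>M * lam) * ((U y)\<^sup>2 + (P y)\<^sup>2)" .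
  have "exp (- rate * H) * (c\<^sub>m * \<delta> * lam * (U z)\<^sup>2) \<le> exp (- rate * H) * energy z"
    by (intro mult_left_mono U_sq_le_energy z) simp
  also have "\<dots> \<le> exp (- rate * H) * (exp (rate * H) * energy y)"
    by (intro mult_left_mono energy_comparison y z) simp
  also have "\<dots> = energy y"
    by (simp add: mult.assoc[symmetric] exp_add[symmetric])
  also note up
  finally have "exp (- rate * H) * (c\<^sub>m * \<delta> * lam * (U z)\<^sup>2) / (1 + c\<^sub>M * lam) \<le> (U y)\<^sup>2 + (P y)\<^sup>2"
    using den by (simp add: divide_le_eq mult.commute)
  moreover have "lam0 / (1 + c\<^sub>M * lam0) \<le> lam / (1 + c\<^sub>M * lam)"
    using den lam0 by (simp add: field_simps)
  then have "exp (- rate * H) * (c\<^sub>m * \<delta>) * (U z)\<^sup>2 * (lam0 / (1 + c\<^sub>M * lam0))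
      \<le> exp (- rate * H) * (c\<^sub>m * \<delta>) * (U z)\<^sup>2 * (lam / (1 + c\<^sub>M * lam))"
    using cm \<delta> by (intro mult_left_mono) auto
  ultimately show ?thesis by (simp add: mult_ac)
qed

end

section \<open>Eigenfunctions and their minimal amplitude\<close>

text \<open>A bootstrap: \<open>u\<close> and \<open>c u'\<close> lie in \<open>H1\<close> and have continuous representatives \<open>U\<close> and \<open>P\<close>; the weak
  derivatives are then continuous as well, the first one being \<open>P / C\<close> by definition of \<open>P\<close> and the second one
  \<open>(C m\<^sup>2 - lam) U\<close> by the eigenvalue equation.\<close>

lemma eigenfunction_classical:
  assumes "H > 0" and "c\<^sub>m > 0" and C: "continuous_on {0..H} C"
    and cC: "AE y in lebesgue_on {0<..<H}. c y = C y"
    and C_lower: "\<And>y. y \<in> {0..H} \<Longrightarrow> c\<^sub>m \<le> C y"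
    and u: "A_eigenfunction H c m lam u"
  obtains U P where
    "continuous_on {0..H} U" "AE y in lebesgue_on {0<..<H}. u y = U y"
    "continuous_on {0..H} P" "AE y in lebesgue_on {0<..<H}. c y * wd H u y = P y"
    "\<forall>y\<in>{0..H}. (U has_real_derivative P y / C y) (at y within {0..H})"
    "\<forall>y\<in>{0..H}. (P has_real_derivative (C y * m\<^sup>2 - lam) * U y) (at y within {0..H})"
proof -
  have uH1: "u \<in> H1 {0<..<H}" and pH1: "(\<lambda>y. c y * wd H u y) \<in> H1 {0<..<H}"
    and eq: "AE y in lebesgue_on {0<..<H}. A_op H c m u y = lam * u y"
    using u by (auto simp: A_eigenfunction_def A_dom_def H10_def)
  obtain U where U: "continuous_on {0..H} U" "AE y in lebesgue_on {0<..<H}. u y = U y"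
    and dU: "\<And>k y. continuous_on {0..H} k \<Longrightarrow> AE x in lebesgue_on {0<..<H}. wd H u x = k x \<Longrightarrow>
       y \<in> {0..H} \<Longrightarrow> (U has_real_derivative k y) (at y within {0..H})"
    using H1_continuous_primitive[OF \<open>H > 0\<close> uH1] by blast
  obtain P where P: "continuous_on {0..H} P" "AE y in lebesgue_on {0<..<H}. c y * wd H u y = P y"
    and dP: "\<And>k y. continuous_on {0..H} k \<Longrightarrow>
       AE x in lebesgue_on {0<..<H}. wd H (\<lambda>y. c y * wd H u y) x = k x \<Longrightarrow>
       y \<in> {0..H} \<Longrightarrow> (P has_real_derivative k y) (at y within {0..H})"
    using H1_continuous_primitive[OF \<open>H > 0\<close> pH1] by blast
  have C0: "C y \<noteq> 0" if "y \<in> {0..H}" for y using C_lower[OF that] \<open>c\<^sub>m > 0\<close> by auto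
  have inI: "AE y in lebesgue_on {0<..<H}. y \<in> {0<..<H}" by (intro AE_I2) simp
  have 1: "AE y in lebesgue_on {0<..<H}. wd H u y = P y / C y"
    using P(2) cC inI by eventually_elim (use C0 in \<open>auto simp: field_simps\<close>)
  have 2: "AE y in lebesgue_on {0<..<H}. wd H (\<lambda>y. c y * wd H u y) y = (C y * m\<^sup>2 - lam) * U y"
    using eq cC U(2) by eventually_elim (simp add: A_op_def algebra_simps)
  have "continuous_on {0..H} (\<lambda>y. P y / C y)"
    by (intro continuous_on_divide P C) (use C0 in blast)
  note U' = dU[OF this 1]
  have "continuous_on {0..H} (\<lambda>y. (C y * m\<^sup>2 - lam) * U y)"
    by (intro continuous_intros C U)
  note P' = dP[OF this 2]
  show thesis
    using U' P' by (intro that[OF U P] ballI)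
qed

theorem proposition5p5:
  fixes \<Omega>' :: "'a::euclidean_space set"
    and H c\<^sub>m c\<^sub>M \<epsilon> :: real
    and \<mu> :: "nat \<Rightarrow> real"
    and c :: "real \<Rightarrow> real"
    and \<beta> :: "nat \<Rightarrow> nat \<Rightarrow> real"
    and u :: "real \<Rightarrow> nat \<Rightarrow> real \<Rightarrow> real"
  assumes "bounded_smooth_domain \<Omega>'"
    and "H > 0"
    and "dirichlet_eigenvalues \<Omega>' \<mu>"
    and "0 < c\<^sub>m" and "c\<^sub>m < c\<^sub>M"
    and "\<epsilon> > 0"
    and "c \<in> coefficients H c\<^sub>m c\<^sub>M"
    and "c \<in> W1_infty {0<..<H}"
    and "A_eigenvalue_enumeration H c \<mu> \<beta>"
    and "\<And>k l. k \<ge> 1 \<Longrightarrow> l \<ge> 1 \<Longrightarrow>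
           normalized_eigenfunction H c (\<mu> k) (\<beta> k l) (u (\<beta> k l) k)"
  shows "minimal_amplitude H c \<mu> u (A_eps \<mu> \<beta> c\<^sub>M \<epsilon>)"
proof -
  obtain L C where "L \<ge> 0" and C: "continuous_on {0..H} C"
    and cC: "AE x in lebesgue_on {0<..<H}. c x = C x"
    and lip: "\<forall>x\<in>{0..H}. \<forall>y\<in>{0..H}. \<bar>C x - C y\<bar> \<le> L * \<bar>x - y\<bar>"
    using W1_infty_Lipschitz_representative[OF \<open>H > 0\<close> \<open>c \<in> W1_infty _\<close>] .
  have "AE x in lebesgue_on {0<..<H}. c\<^sub>m \<le> C x" "AE x in lebesgue_on {0<..<H}. - c\<^sub>M \<le> - C x"
    using cC coefficients_AE_bounds[OF \<open>c \<in> coefficients _ _ _\<close>] by (eventually_elim, simp)+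
  then have bounds: "c\<^sub>m \<le> C y \<and> C y \<le> c\<^sub>M" if "y \<in> {0..H}" for y
    using continuous_AE_ge[OF \<open>H > 0\<close> C, of c\<^sub>m y]
      continuous_AE_ge[OF \<open>H > 0\<close> continuous_on_minus[OF C], of "- c\<^sub>M" y] that by auto
  define \<delta> where "\<delta> = \<epsilon> / (c\<^sub>M + \<epsilon>)"
  define lam0 where "lam0 = (c\<^sub>M + \<epsilon>) * (\<mu> 1)\<^sup>2"
  \<comment> \<open>\<open>K\<close> is \<open>rate\<close>, spelled out because it must be fixed before any eigenfunction is.\<close>
  define K where "K = L / (c\<^sub>m * \<delta>) + 1"
  define R where "R = exp (- K * H) * (c\<^sub>m * \<delta> * (lam0 / (1 + c\<^sub>M * lam0))) * (1 / H)"
  have cM: "c\<^sub>M > 0" using assms(4,5) by simp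
  have \<delta>: "\<delta> > 0" using cM \<open>\<epsilon> > 0\<close> by (simp add: \<delta>_def)
  have \<mu>pos: "\<mu> k > 0" and \<mu>mono: "(\<mu> 1)\<^sup>2 \<le> (\<mu> k)\<^sup>2" if "k \<ge> 1" for k
    using \<open>dirichlet_eigenvalues \<Omega>' \<mu>\<close> that by (auto simp: dirichlet_eigenvalues_def)
  have lam0: "lam0 > 0" using cM \<open>\<epsilon> > 0\<close> \<mu>pos[of 1] by (simp add: lam0_def)
  have "R > 0"
    unfolding R_def using \<open>H > 0\<close> \<open>0 < c\<^sub>m\<close> cM \<delta> lam0 by (simp add: add_pos_pos)
  have amplitude: "R \<le> amplitude_sq H c (u lam k) y"
    if y: "y \<in> {0..H}" and "k \<ge> 1" and A: "(\<mu> k, lam) \<in> A_eps \<mu> \<beta> c\<^sub>M \<epsilon>" for y k lam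
  proof -
    obtain k' l where k': "k' \<ge> 1" "\<mu> k = \<mu> k'" "l \<ge> 1" "lam = \<beta> k' l"
      and large: "(c\<^sub>M + \<epsilon>) * (\<mu> k)\<^sup>2 \<le> lam"
      using A by (auto simp: A_eps_def)
    \<comment> \<open>Membership only gives an index \<open>k'\<close> with the same value of \<open>\<mu>\<close>, which may differ from \<open>k\<close> if that
      value is repeated; the operator depends on the value only.\<close>
    have "lam \<in> A_eigenvalues H c (\<mu> k)"
      using assms(9) k' unfolding A_eigenvalue_enumeration_def by force
    then obtain l' where "l' \<ge> 1" "lam = \<beta> k l'"
      using assms(9) \<open>k \<ge> 1\<close> unfolding A_eigenvalue_enumeration_def by (metis atLeast_iff imageE)
    then have "normalized_eigenfunction H c (\<mu> k) lam (u lam k)"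
      using assms(10)[OF \<open>k \<ge> 1\<close>] by simp
    then have eu: "A_eigenfunction H c (\<mu> k) lam (u lam k)"
      and norm: "(LINT y|lebesgue_on {0<..<H}. (u lam k y)\<^sup>2) = 1"
      by (auto simp: normalized_eigenfunction_def)
    obtain U P where U: "continuous_on {0..H} U" "AE y in lebesgue_on {0<..<H}. u lam k y = U y"
      and P: "continuous_on {0..H} P" "AE y in lebesgue_on {0<..<H}. c y * wd H (u lam k) y = P y"
      and dU: "\<forall>y\<in>{0..H}. (U has_real_derivative P y / C y) (at y within {0..H})"
      and dP: "\<forall>y\<in>{0..H}.
        (P has_real_derivative (C y * (\<mu> k)\<^sup>2 - lam) * U y) (at y within {0..H})"
      using eigenfunction_classical[OF \<open>H > 0\<close> \<open>0 < c\<^sub>m\<close> C cC conjunct1[OF bounds] eu] .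
    have "lam0 \<le> (c\<^sub>M + \<epsilon>) * (\<mu> k)\<^sup>2"
      unfolding lam0_def using \<mu>mono[OF \<open>k \<ge> 1\<close>] cM \<open>\<epsilon> > 0\<close> by (intro mult_left_mono) auto
    then have lam_ge: "lam0 \<le> lam" using large by simp
    have "c\<^sub>M * ((c\<^sub>M + \<epsilon>) * (\<mu> k)\<^sup>2) \<le> c\<^sub>M * lam"
      using large cM by (intro mult_left_mono) auto
    then have "c\<^sub>M * (\<mu> k)\<^sup>2 \<le> (1 - \<delta>) * lam"
      using cM \<open>\<epsilon> > 0\<close> by (simp add: \<delta>_def field_simps)
    then interpret sturm_liouville_solution H L c\<^sub>m c\<^sub>M \<delta> "(\<mu> k)\<^sup>2" lam C U P
      using \<open>H > 0\<close> \<open>0 < c\<^sub>m\<close> \<delta> lam0 lam_ge \<open>L \<ge> 0\<close> bounds lip dU dP by unfold_locales auto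
    have "u lam k \<in> L2 {0<..<H}"
      using eu by (simp add: A_eigenfunction_def A_dom_def H10_def H1_def)
    then obtain z where z: "z \<in> {0..H}" "1 / H \<le> (U z)\<^sup>2"
      using normalized_sq_attains[OF \<open>H > 0\<close> U _ norm] by blast
    have "R \<le> exp (- rate * H) * (c\<^sub>m * \<delta> * (lam0 / (1 + c\<^sub>M * lam0))) * (U z)\<^sup>2"
      unfolding R_def K_def rate_def using z(2) \<open>0 < c\<^sub>m\<close> \<delta> lam0 cM by (intro mult_left_mono) auto
    also have "\<dots> \<le> (U y)\<^sup>2 + (P y)\<^sup>2"
      by (rule amplitude_lower_bound[OF y z(1) lam0 lam_ge])
    also have "\<dots> = amplitude_sq H c (u lam k) y"
      unfolding amplitude_sq_def using cont_rep_eq[OF \<open>H > 0\<close> U y] cont_rep_eq[OF \<open>H > 0\<close> P y] by simp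
    finally show ?thesis .
  qed
  have "ereal R \<le> min_amplitude_sq H c \<mu> u (A_eps \<mu> \<beta> c\<^sub>M \<epsilon>)"
    unfolding min_amplitude_sq_def by (rule INF_greatest) (use amplitude in auto)
  then show ?thesis
    unfolding minimal_amplitude_def using \<open>R > 0\<close> by (metis ereal_less(2) less_le_trans)
qed

end
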